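(* Let $d_1,d_2,m\ge1$ be integers and let $1\le r\le\min(d_1,d_2)$ be an integer. Let $A_1,\dots,A_m$ be independent $d_1\times d_2$ random matrices, each with i.i.d. $N(0,1)$ entries. For each $d_1\times d_2$ real matrix $X$ let $y_i=\langle A_i,X\rangle$, $i=1,\dots,m$, and choose $\widehat{X}$ (depending on the $A_i$ and $y_i$) to be a solution to the convex program $$\text{minimize } \|X'\|_*\ \text{ subject to }\ \langle A_i,X'\rangle=y_i,\quad i=1,\dots,m .$$ Then $$\mathbb{E}\,\sup_X\frac{\|\widehat{X}-X\|_F}{\|X\|_F}\le4\sqrt{\pi}\,\sqrt{\frac{r(d_1+d_2)}{m}},$$ where the supremum is taken over all non-zero $d_1\times d_2$ matrices $X$ of rank at most $r$.
   Context: For $d_1\times d_2$ matrices, $\langle X,Y\rangle=\mathrm{tr}(X^{\mathsf T}Y)$, $\|X\|_F$ is the Frobenius norm, and $\|X\|_*$ is the nuclear norm (the sum of the singular values of $X$). *)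

theory Defs
  imports "HOL-Analysis.Analysis" "HOL-Probability.Probability"
begin

definition mat_inner :: "real^'n^'m \<Rightarrow> real^'n^'m \<Rightarrow> real" where
  "mat_inner X Y = trace (transpose X ** Y)"

lemma mat_inner_eq_inner: "mat_inner X Y = X \<bullet> Y"
proof -
  have "mat_inner X Y = (\<Sum>j\<in>UNIV. \<Sum>i\<in>UNIV. X $ i $ j * Y $ i $ j)"
    by (simp add: mat_inner_def trace_def matrix_matrix_mult_def transpose_def)
  also have "\<dots> = X \<bullet> Y"
    by (subst sum.swap) (simp add: inner_vec_def)
  finally show ?thesis .
qed

text \<open>The library norm on matrices is the Frobenius norm.\<close>

lemma norm_eq_frobenius: "norm X = sqrt (\<Sum>i\<in>UNIV. \<Sum>j\<in>UNIV. (X $ i $ j)\<^sup>2)"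
  for X :: "real^'n^'m"
  by (simp add: norm_eq_sqrt_inner inner_vec_def power2_eq_square)

definition eigenspace :: "real^'n^'n \<Rightarrow> real \<Rightarrow> (real^'n) set" where
  "eigenspace S c = {v. S *v v = c *\<^sub>R v}"

text \<open>The singular values of \<open>X\<close> are the nonnegative square roots of the eigenvalues of
  \<open>X\<^sup>T X\<close>. Since that matrix is symmetric, the algebraic multiplicity of an eigenvalue is the
  dimension of its eigenspace. Compared with conventions that list only \<open>min d\<^sub>1 d\<^sub>2\<close> singular
  values, only the multiplicity of the singular value 0 differs.\<close>

definition singular_values :: "real^'n^'m \<Rightarrow> real set" where
  "singular_values X = {s. s \<ge> 0 \<and> eigenspace (transpose X ** X) (s\<^sup>2) \<noteq> {0}}"

definition singular_mult :: "real^'n^'m \<Rightarrow> real \<Rightarrow> nat" where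
  "singular_mult X s = dim (eigenspace (transpose X ** X) (s\<^sup>2))"

definition nuclear_norm :: "real^'n^'m \<Rightarrow> real" where
  "nuclear_norm X = (\<Sum>s\<in>singular_values X. real (singular_mult X s) * s)"

lemma finite_singular_values: "finite (singular_values X)"
proof -
  let ?S = "transpose X ** X"
  have sym: "(?S *v u) \<bullet> v = u \<bullet> (?S *v v)" for u v
  proof -
    have "transpose ?S = ?S"
      by (simp add: matrix_transpose_mul)
    then have "?S *v u = u v* ?S"
      by (metis transpose_matrix_vector)
    then show ?thesis
      by (simp only: dot_lmul_matrix)
  qed
  have "\<exists>v. v \<noteq> 0 \<and> v \<in> eigenspace ?S (s\<^sup>2)" if "s \<in> singular_values X" for s
  proof -
    have "0 \<in> eigenspace ?S (s\<^sup>2)"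
      by (simp add: eigenspace_def)
    then show ?thesis
      using that unfolding singular_values_def by blast
  qed
  then have "\<forall>s\<in>singular_values X. \<exists>v. v \<noteq> 0 \<and> ?S *v v = s\<^sup>2 *\<^sub>R v"
    by (simp only: eigenspace_def mem_Collect_eq) blast
  from bchoice [OF this]
  obtain e where e: "\<And>s. s \<in> singular_values X \<Longrightarrow> e s \<noteq> 0 \<and> ?S *v e s = s\<^sup>2 *\<^sub>R e s"
    by blast
  have orth: "e s \<bullet> e t = 0"
    if "s \<in> singular_values X" "t \<in> singular_values X" "s \<noteq> t" for s t
  proof -
    have "s\<^sup>2 * (e s \<bullet> e t) = t\<^sup>2 * (e s \<bullet> e t)"
      using sym[of "e s" "e t"] e[OF that(1)] e[OF that(2)]
      by (simp only: inner_scaleR_left inner_scaleR_right)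
    moreover have "s\<^sup>2 \<noteq> t\<^sup>2"
      using that by (auto simp: singular_values_def)
    ultimately show ?thesis by simp
  qed
  have "inj_on e (singular_values X)"
  proof (rule inj_onI, rule ccontr)
    fix s t assume st: "s \<in> singular_values X" "t \<in> singular_values X" "e s = e t" "s \<noteq> t"
    then have "e s \<bullet> e s = 0"
      using orth[of s t] by simp
    then show False
      using e[OF st(1)] by simp
  qed
  moreover have "pairwise orthogonal (e ` singular_values X)"
    unfolding pairwise_def orthogonal_def using orth by blast
  then have "finite (e ` singular_values X)"
  proof -
    assume "pairwise orthogonal (e ` singular_values X)"
    moreover have "0 \<notin> e ` singular_values X"
      using e by fastforce
    ultimately show ?thesis
      using independent_bound pairwise_orthogonal_independent by blast
  qed
  ultimately show ?thesis
    by (metis finite_imageD)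
qed

definition is_nuclear_minimizer ::
    "('k \<Rightarrow> real^'n^'m) \<Rightarrow> ('k \<Rightarrow> real) \<Rightarrow> real^'n^'m \<Rightarrow> bool" where
  "is_nuclear_minimizer a y Z \<longleftrightarrow>
     (\<forall>i. mat_inner (a i) Z = y i) \<and>
     (\<forall>X'. (\<forall>i. mat_inner (a i) X' = y i) \<longrightarrow> nuclear_norm Z \<le> nuclear_norm X')"

text \<open>A minimizer need not be unique, and for an arbitrary choice of minimizers a supremum
  of the errors need not be measurable. On non-measurable functions \<open>nn_integral\<close>
  is a lower integral, so an upper bound on it would say too little. The outer expectation below
  is the expectation whenever the latter makes sense, and it bounds every
  measurable version from above.\<close>

definition outer_expectation :: "'a measure \<Rightarrow> ('a \<Rightarrow> ennreal) \<Rightarrow> ennreal" where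
  "outer_expectation M f =
     (INF g \<in> {g \<in> borel_measurable M. \<forall>x\<in>space M. f x \<le> g x}. \<integral>\<^sup>+ x. g x \<partial>M)"

lemma outer_expectation_eq_nn_integral:
  assumes "f \<in> borel_measurable M"
  shows "outer_expectation M f = (\<integral>\<^sup>+ x. f x \<partial>M)"
  unfolding outer_expectation_def
proof (rule antisym)
  show "(INF g \<in> {g \<in> borel_measurable M. \<forall>x\<in>space M. f x \<le> g x}. \<integral>\<^sup>+ x. g x \<partial>M) \<le> (\<integral>\<^sup>+ x. f x \<partial>M)"
    by (rule INF_lower) (use assms in auto)
  show "(\<integral>\<^sup>+ x. f x \<partial>M) \<le> (INF g \<in> {g \<in> borel_measurable M. \<forall>x\<in>space M. f x \<le> g x}. \<integral>\<^sup>+ x. g x \<partial>M)"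
    by (rule INF_greatest) (auto intro!: nn_integral_mono)
qed

end

theory Submission
  imports Defs
begin

text \<open>Rescale to \<open>norm X = 1\<close>. The error \<open>h = Xhat - X\<close> lies in the kernel of the measurements, and
  since both matrices have nuclear norm at most \<open>sqrt r\<close>, it lies in a set \<open>T\<close> on which
  \<open>G \<bullet> h \<le> 2 * sqrt r * onorm G\<close> for all \<open>G\<close>. With \<open>c = sqrt (2 / pi)\<close>, the mean of \<open>\<bar>A\<^sub>i \<bullet> h\<bar>\<close> is \<open>c * norm h\<close>,
  so \<open>c * m * norm h\<close> is at most the supremum over \<open>T\<close> of \<open>\<Sum>i. c * norm h - \<bar>A\<^sub>i \<bullet> h\<bar>\<close>. Symmetrization
  and contraction bound its expectation by that of the supremum of \<open>2 * (\<Sum>i. A\<^sub>i) \<bullet> h\<close>, which is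
  at most \<open>4 * sqrt r * sqrt m\<close> times the expected operator norm of one Gaussian matrix. The
  latter is at most \<open>sqrt 2 * sqrt (d\<^sub>1 + d\<^sub>2)\<close> by the Sudakov--Fernique comparison of
  \<open>v \<bullet> (G *v u)\<close> with \<open>g \<bullet> u + g' \<bullet> v\<close>.\<close>

section \<open>Singular values and the nuclear norm\<close>

text \<open>\<open>Xhat\<close> is arbitrary, so the supremum of the errors over \<open>X\<close>
  need not be measurable. Both the supremum and the measurability are handled through
  \<open>T\<close>, which depends on \<open>r\<close> but neither on \<open>X\<close> nor on the
  measurements: for each outcome, one supremum of continuous functions over \<open>T\<close>
  controls all rescaled errors at once, and it is a measurable majorant. The comparison and
  contraction arguments concern finite maxima; continuity and an integrable envelope carry their
  bounds over to infinite index sets. The rate comes from the mismatch between a lower bound linear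
  in \<open>m\<close> and a sum of independent Gaussian matrices of size \<open>sqrt m\<close>. In
  the constant, symmetrization and the two nuclear norms contribute a factor 2 each; the
  \<open>sqrt 2\<close> of the operator norm is the length of a pair of unit vectors, and
  \<open>sqrt 2 / c\<close> is \<open>sqrt pi\<close>.\<close>

lemma linear_le_quadratic_imp_zero:
  fixes a K :: real
  assumes le: "\<And>t. 2 * t * a \<le> t\<^sup>2 * K"
  shows "a = 0"
proof (rule ccontr)
  assume a: "a \<noteq> 0"
  then have a2: "a\<^sup>2 > 0" by simp
  have K: "K > 0"
  proof (rule ccontr)
    assume "\<not> K > 0"
    then have "a\<^sup>2 * K \<le> 0" by (simp add: mult_nonneg_nonpos)
    moreover have "2 * a\<^sup>2 \<le> a\<^sup>2 * K"
      using le[of a] by (simp add: power2_eq_square)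
    ultimately show False using a2 by linarith
  qed
  have "2 * (a\<^sup>2 / K) \<le> a\<^sup>2 / K"
    using le[of "a / K"] K by (simp add: power2_eq_square)
  then show False using a2 K divide_pos_pos[OF a2 K] by linarith
qed

text \<open>The spectral theorem, stated on an invariant subspace \<open>V\<close> so that induction
  on the dimension works: maximizing \<open>x \<bullet> f x\<close> over the unit sphere of
  \<open>V\<close> yields an eigenvector, and its orthogonal complement in \<open>V\<close> is again
  invariant because \<open>f\<close> is self-adjoint.\<close>

lemma self_adjoint_orthonormal_eigenbasis:
  fixes f :: "'a::euclidean_space \<Rightarrow> 'a"
  assumes lin: "linear f" and adj: "\<And>x y. f x \<bullet> y = x \<bullet> f y"
    and V: "subspace V" "\<And>x. x \<in> V \<Longrightarrow> f x \<in> V"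
  shows "\<exists>B. finite B \<and> B \<subseteq> V \<and> pairwise orthogonal B \<and> (\<forall>b\<in>B. norm b = 1) \<and> span B = V \<and>
    (\<forall>b\<in>B. \<exists>c. f b = c *\<^sub>R b)"
  using V
proof (induction "dim V" arbitrary: V rule: less_induct)
  case less
  show ?case
  proof (cases "V \<subseteq> {0}")
    case True
    then have "V = {0}" using subspace_0[OF less.prems(1)] by auto
    then show ?thesis by (intro exI[of _ "{}"]) auto
  next
    case False
    then obtain v where v: "v \<in> V" "v \<noteq> 0" by auto
    let ?S = "V \<inter> sphere 0 1"
    have "v /\<^sub>R norm v \<in> ?S"
      using v less.prems(1) by (auto simp: subspace_scale)
    then have "?S \<noteq> {}" by blast
    moreover have "compact ?S"
      using closed_subspace[OF less.prems(1)] by (simp add: closed_Int_compact)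
    moreover have "continuous_on ?S (\<lambda>x. x \<bullet> f x)"
      using linear_continuous_on[OF linear_conv_bounded_linear[THEN iffD1, OF lin]]
      by (intro continuous_intros)
    ultimately obtain b where b: "b \<in> ?S" and max: "\<And>x. x \<in> ?S \<Longrightarrow> x \<bullet> f x \<le> b \<bullet> f b"
      using continuous_attains_sup[of ?S "\<lambda>x. x \<bullet> f x"] by blast
    define c where "c = b \<bullet> f b"
    have nb: "b \<in> V" "norm b = 1" "b \<bullet> b = 1"
      using b by (auto simp: dot_square_norm)
    have quad: "x \<bullet> f x \<le> c * (x \<bullet> x)" if "x \<in> V" for x
    proof (cases "x = 0")
      case False
      have "x /\<^sub>R norm x \<in> ?S" using that False less.prems(1) by (auto simp: subspace_scale)
      from max[OF this] have "(x \<bullet> f x) / (norm x)\<^sup>2 \<le> c"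
        by (simp add: c_def linear_scale[OF lin] power2_eq_square field_simps)
      then show ?thesis
        using False by (simp add: divide_le_eq dot_square_norm)
    qed (simp add: linear_0[OF lin])
    \<comment> \<open>First variation at the maximizer: for \<open>b + t *\<^sub>R w\<close> the
      constant terms on the two sides of \<open>quad\<close> agree, so for every real
      \<open>t\<close> the linear term is dominated by a quadratic one and must vanish.\<close>
    have perp: "w \<bullet> f b = 0" if w: "w \<in> V" "w \<bullet> b = 0" for w
    proof (rule linear_le_quadratic_imp_zero)
      fix t
      have "b + t *\<^sub>R w \<in> V"
        using less.prems(1) nb w by (simp add: subspace_add subspace_scale)
      from quad[OF this] show "2 * t * (w \<bullet> f b) \<le> t\<^sup>2 * (c * (w \<bullet> w) - w \<bullet> f w)"
        using w(2) nb adj[of w b]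
        by (simp add: linear_add[OF lin] linear_scale[OF lin] algebra_simps inner_commute c_def power2_eq_square)
    qed
    \<comment> \<open>The residual \<open>?w\<close> lies in \<open>V\<close> and is orthogonal to
      \<open>b\<close> by the choice of \<open>c\<close>; by \<open>perp\<close> it is also
      orthogonal to \<open>f b\<close>, hence to itself.\<close>
    have fb: "f b = c *\<^sub>R b"
    proof -
      let ?w = "f b - c *\<^sub>R b"
      have "?w \<in> V" using less.prems nb by (simp add: subspace_diff subspace_scale)
      moreover have wb: "?w \<bullet> b = 0"
        using nb adj[of b b] by (simp add: inner_diff_left c_def)
      ultimately have "?w \<bullet> f b = 0" by (rule perp)
      then have "?w \<bullet> ?w = 0" using wb by (simp add: inner_diff_right)
      then show ?thesis by simp
    qed
    define W where "W = {x \<in> V. x \<bullet> b = 0}"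
    have W: "subspace W"
      using less.prems(1) by (auto simp: W_def subspace_def inner_add_left)
    have fW: "f x \<in> W" if "x \<in> W" for x
      using that less.prems(2) by (simp add: W_def adj fb)
    have "W \<subseteq> V" "b \<notin> W" using nb by (auto simp: W_def)
    then have "W \<subset> V" using nb(1) by blast
    then have "dim W < dim V"
      using W less.prems(1) by (metis dim_psubset span_eq_iff)
    from less.hyps[OF this W fW] obtain B where B: "finite B" "B \<subseteq> W" "pairwise orthogonal B"
      "\<forall>b\<in>B. norm b = 1" "span B = W" "\<forall>b\<in>B. \<exists>c. f b = c *\<^sub>R b" by blast
    have "span (insert b B) = V"
    proof
      show "span (insert b B) \<subseteq> V"
        using B(2) nb less.prems(1) by (intro span_minimal) (auto simp: W_def)
      show "V \<subseteq> span (insert b B)"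
      proof
        fix x assume x: "x \<in> V"
        have "x - (x \<bullet> b) *\<^sub>R b \<in> W"
          using x nb less.prems(1) by (simp add: W_def inner_diff_left subspace_diff subspace_scale)
        then have "x - (x \<bullet> b) *\<^sub>R b \<in> span B" using B(5) by simp
        then show "x \<in> span (insert b B)"
          using span_breakdown_eq[of x b B] by blast
      qed
    qed
    moreover have "pairwise orthogonal (insert b B)"
      using B(2,3) by (intro pairwise_orthogonal_insert) (auto simp: W_def orthogonal_def inner_commute)
    ultimately show ?thesis
      using B nb fb by (intro exI[of _ "insert b B"]) (auto simp: W_def)
  qed
qed

section \<open>Right singular bases, trace duality and the rank bound\<close>

lemma transpose_mult_inner: "((transpose X ** X) *v u) \<bullet> v = (X *v u) \<bullet> (X *v v)" for X :: "real^'n^'m"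
  by (metis dot_lmul_matrix matrix_vector_mul_assoc transpose_matrix_vector transpose_transpose inner_commute)

text \<open>Replaces eigenspace dimensions by a sum over an orthonormal eigenbasis of
  \<open>transpose X ** X\<close>, that is, over right singular vectors \<open>b\<close> with
  singular values \<open>norm (X *v b)\<close>. The orthogonal images \<open>X *v b\<close> stand in
  for the left singular vectors, so vanishing singular values require no separate case.\<close>

lemma nuclear_norm_eigenbasis:
  fixes X :: "real^'n^'m"
  obtains B where "finite B" "pairwise orthogonal B" "\<And>b. b \<in> B \<Longrightarrow> norm b = 1" "span B = UNIV"
    "nuclear_norm X = (\<Sum>b\<in>B. norm (X *v b))"
    "\<And>b c. b \<in> B \<Longrightarrow> c \<in> B \<Longrightarrow> b \<noteq> c \<Longrightarrow> (X *v b) \<bullet> (X *v c) = 0"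
proof -
  let ?S = "transpose X ** X"
  have "\<exists>B. finite B \<and> B \<subseteq> UNIV \<and> pairwise orthogonal B \<and> (\<forall>b\<in>B. norm b = 1) \<and> span B = UNIV \<and>
    (\<forall>b\<in>B. \<exists>c. ?S *v b = c *\<^sub>R b)"
  proof (rule self_adjoint_orthonormal_eigenbasis)
    show "(?S *v x) \<bullet> y = x \<bullet> (?S *v y)" for x y
      using transpose_mult_inner[of X x y] transpose_mult_inner[of X y x] by (simp add: inner_commute)
  qed simp_all
  then obtain B where B: "finite B" "pairwise orthogonal B" "\<And>b. b \<in> B \<Longrightarrow> norm b = 1" "span B = UNIV"
    and ex: "\<And>b. b \<in> B \<Longrightarrow> \<exists>c. ?S *v b = c *\<^sub>R b" by blast
  have ev: "?S *v b = (norm (X *v b))\<^sup>2 *\<^sub>R b" if "b \<in> B" for b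
  proof -
    obtain c where c: "?S *v b = c *\<^sub>R b" using ex[OF \<open>b \<in> B\<close>] by blast
    then have "c = (norm (X *v b))\<^sup>2"
      using transpose_mult_inner[of X b b] B(3)[OF that] by (simp add: dot_square_norm)
    with c show ?thesis by simp
  qed
  have orthX: "(X *v b) \<bullet> (X *v c) = 0" if "b \<in> B" "c \<in> B" "b \<noteq> c" for b c
    using transpose_mult_inner[of X b c] ev[OF that(1)] B(2) that
    by (auto simp: pairwise_def orthogonal_def)
  have ind: "independent B"
    using B(2,3) by (intro pairwise_orthogonal_independent) force+
  \<comment> \<open>An eigenvector for \<open>s\<^sup>2\<close> has no component along basis vectors
    with another eigenvalue; nonnegativity makes different singular values have different
    squares.\<close>
  have space: "eigenspace ?S (s\<^sup>2) = span {b \<in> B. norm (X *v b) = s}" if "s \<ge> 0" for s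
  proof
    have sub: "subspace (eigenspace ?S (s\<^sup>2))"
      by (auto simp: eigenspace_def subspace_def matrix_vector_right_distrib scaleR_add_right
          matrix_vector_mult_scaleR mult.commute)
    show "span {b \<in> B. norm (X *v b) = s} \<subseteq> eigenspace ?S (s\<^sup>2)"
      using ev by (intro span_minimal sub) (auto simp: eigenspace_def)
    show "eigenspace ?S (s\<^sup>2) \<subseteq> span {b \<in> B. norm (X *v b) = s}"
    proof
      fix x assume "x \<in> eigenspace ?S (s\<^sup>2)"
      then have x: "?S *v x = s\<^sup>2 *\<^sub>R x" by (simp add: eigenspace_def)
      have "x \<in> span B" using B(4) by simp
      then have xrep: "x = (\<Sum>b\<in>B. (x \<bullet> b) *\<^sub>R b)"
        using orthonormal_basis_expand[OF B(2)] B(1,3) by simp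
      have "x \<bullet> b = 0" if "b \<in> B" "norm (X *v b) \<noteq> s" for b
      proof -
        have "(norm (X *v b))\<^sup>2 * (x \<bullet> b) = s\<^sup>2 * (x \<bullet> b)"
          using transpose_mult_inner[of X b x] transpose_mult_inner[of X x b] x ev[OF that(1)]
          by (simp add: inner_commute)
        moreover have "(norm (X *v b))\<^sup>2 \<noteq> s\<^sup>2" using that \<open>s \<ge> 0\<close> by simp
        ultimately show ?thesis by simp
      qed
      then have "\<forall>b\<in>B - {b \<in> B. norm (X *v b) = s}. (x \<bullet> b) *\<^sub>R b = 0" by auto
      then have "x = (\<Sum>b\<in>{b \<in> B. norm (X *v b) = s}. (x \<bullet> b) *\<^sub>R b)"
        by (subst xrep) (intro sum.mono_neutral_right B(1), auto)
      also have "\<dots> \<in> span {b \<in> B. norm (X *v b) = s}"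
        by (intro span_sum span_scale span_base)
      finally show "x \<in> span {b \<in> B. norm (X *v b) = s}" .
    qed
  qed
  have mult: "singular_mult X s = card {b \<in> B. norm (X *v b) = s}" if "s \<ge> 0" for s
  proof -
    have "independent {b \<in> B. norm (X *v b) = s}"
      by (rule independent_mono[OF ind]) auto
    then show ?thesis
      by (simp add: singular_mult_def space[OF that] dim_span dim_eq_card_independent)
  qed
  have sv: "singular_values X = (\<lambda>b. norm (X *v b)) ` B"
  proof -
    have eig: "eigenspace ?S (s\<^sup>2) \<noteq> {0} \<longleftrightarrow> (\<exists>b\<in>B. norm (X *v b) = s)" if "s \<ge> 0" for s
    proof -
      let ?T = "{b \<in> B. norm (X *v b) = s}"
      have "span ?T \<noteq> {0} \<longleftrightarrow> ?T \<noteq> {}"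
      proof (cases "?T = {}")
        case False
        then obtain b where b: "b \<in> ?T" by blast
        then have "b \<noteq> 0" using B(3)[of b] by auto
        with span_base[OF b] False show ?thesis by blast
      next
        case True
        show ?thesis unfolding True by simp
      qed
      then show ?thesis unfolding space[OF that] by blast
    qed
    have *: "s \<in> singular_values X \<longleftrightarrow> s \<ge> 0 \<and> (\<exists>b\<in>B. norm (X *v b) = s)" for s
      unfolding singular_values_def mem_Collect_eq by (intro conj_cong refl eig)
    show ?thesis
      by (intro set_eqI) (metis (no_types, lifting) * image_iff norm_ge_zero)
  qed
  have "nuclear_norm X = (\<Sum>s\<in>(\<lambda>b. norm (X *v b)) ` B. \<Sum>b\<in>{b \<in> B. norm (X *v b) = s}. norm (X *v b))"
    unfolding nuclear_norm_def sv
  proof (rule sum.cong)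
    fix s assume "s \<in> (\<lambda>b. norm (X *v b)) ` B"
    then have "s \<ge> 0" by auto
    then show "real (singular_mult X s) * s = (\<Sum>b\<in>{b \<in> B. norm (X *v b) = s}. norm (X *v b))"
      by (simp add: mult)
  qed simp
  also have "\<dots> = (\<Sum>b\<in>B. norm (X *v b))"
    using B(1) by (rule sum.image_gen[symmetric])
  finally have "nuclear_norm X = (\<Sum>b\<in>B. norm (X *v b))" .
  then show ?thesis
    using B orthX by (intro that[of B]) (auto simp: pairwise_def orthogonal_def)
qed

lemma orthonormal_sum_inner:
  fixes B :: "'a::euclidean_space set"
  assumes "finite B" "pairwise orthogonal B" "\<And>b. b \<in> B \<Longrightarrow> norm b = 1" "span B = UNIV"
  shows "x \<bullet> y = (\<Sum>b\<in>B. (x \<bullet> b) * (y \<bullet> b))"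
proof -
  have "(\<Sum>b\<in>B. (x \<bullet> b) *\<^sub>R b) = x"
    using assms by (intro orthonormal_basis_expand) auto
  then have "x \<bullet> y = (\<Sum>b\<in>B. (x \<bullet> b) *\<^sub>R b) \<bullet> y" by simp
  also have "\<dots> = (\<Sum>b\<in>B. (x \<bullet> b) * (y \<bullet> b))"
    by (simp only: inner_sum_left inner_scaleR_left) (simp add: inner_commute)
  finally show ?thesis .
qed

lemma matrix_inner_orthonormal:
  fixes X Y :: "real^'n^'m"
  assumes "finite B" "pairwise orthogonal B" "\<And>b. b \<in> B \<Longrightarrow> norm b = 1" "span B = UNIV"
  shows "X \<bullet> Y = (\<Sum>b\<in>B. (X *v b) \<bullet> (Y *v b))"
proof -
  have "X \<bullet> Y = (\<Sum>i\<in>UNIV. \<Sum>b\<in>B. (X $ i \<bullet> b) * (Y $ i \<bullet> b))"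
    unfolding inner_vec_def[of X Y] by (intro sum.cong refl orthonormal_sum_inner assms)
  also have "\<dots> = (\<Sum>b\<in>B. (X *v b) \<bullet> (Y *v b))"
    by (subst sum.swap) (simp add: inner_vec_def[of "X *v _"] matrix_vector_mul_component)
  finally show ?thesis .
qed

text \<open>Trace duality: in the right singular basis of \<open>X\<close> the inner product splits
  into terms \<open>(G *v b) \<bullet> (X *v b)\<close>, each at most the operator norm of
  \<open>G\<close> times one singular value of \<open>X\<close>.\<close>

lemma inner_le_onorm_nuclear_norm:
  fixes G X :: "real^'n^'m"
  shows "G \<bullet> X \<le> onorm ((*v) G) * nuclear_norm X"
proof -
  obtain B where B: "finite B" "pairwise orthogonal B" "\<And>b. b \<in> B \<Longrightarrow> norm b = 1" "span B = UNIV"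
    "nuclear_norm X = (\<Sum>b\<in>B. norm (X *v b))"
    by (rule nuclear_norm_eigenbasis[of X]) blast
  have "G \<bullet> X = (\<Sum>b\<in>B. (G *v b) \<bullet> (X *v b))"
    by (rule matrix_inner_orthonormal[OF B(1-4)])
  also have "\<dots> \<le> (\<Sum>b\<in>B. onorm ((*v) G) * norm (X *v b))"
  proof (rule sum_mono)
    fix b assume "b \<in> B"
    have "(G *v b) \<bullet> (X *v b) \<le> norm (G *v b) * norm (X *v b)" by (rule norm_cauchy_schwarz)
    also have "\<dots> \<le> onorm ((*v) G) * norm (X *v b)"
      using onorm[OF matrix_vector_mul_bounded_linear, of G b] B(3)[OF \<open>b \<in> B\<close>]
      by (intro mult_right_mono) auto
    finally show "(G *v b) \<bullet> (X *v b) \<le> onorm ((*v) G) * norm (X *v b)" .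
  qed
  finally show ?thesis by (simp add: B(5) sum_distrib_left)
qed

text \<open>Cauchy-Schwarz over the nonzero singular values, whose squares sum to the squared
  Frobenius norm. Their number is at most the rank because the corresponding images are nonzero,
  mutually orthogonal vectors in the range of \<open>X\<close>.\<close>

lemma nuclear_norm_le_sqrt_rank:
  fixes X :: "real^'n^'m"
  shows "nuclear_norm X \<le> sqrt (rank X) * norm X"
proof -
  obtain B where B: "finite B" "pairwise orthogonal B" "\<And>b. b \<in> B \<Longrightarrow> norm b = 1" "span B = UNIV"
    "nuclear_norm X = (\<Sum>b\<in>B. norm (X *v b))"
    "\<And>b c. b \<in> B \<Longrightarrow> c \<in> B \<Longrightarrow> b \<noteq> c \<Longrightarrow> (X *v b) \<bullet> (X *v c) = 0"
    by (rule nuclear_norm_eigenbasis[of X]) blast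
  define C where "C = {b \<in> B. X *v b \<noteq> 0}"
  have C: "finite C" "C \<subseteq> B" using B(1) by (auto simp: C_def)
  have inj: "inj_on ((*v) X) C"
  proof (rule inj_onI, rule ccontr)
    fix b c assume bc: "b \<in> C" "c \<in> C" "X *v b = X *v c" "b \<noteq> c"
    then have "(X *v b) \<bullet> (X *v b) = 0" using B(6)[of b c] by (simp add: C_def)
    then show False using bc(1) by (simp add: C_def)
  qed
  have "pairwise orthogonal ((*v) X ` C)"
    using B(6) C(2) by (auto simp: pairwise_def orthogonal_def)
  then have "independent ((*v) X ` C)"
    by (rule pairwise_orthogonal_independent) (auto simp: C_def)
  then have "card ((*v) X ` C) \<le> dim (range ((*v) X))"
    by (intro independent_card_le_dim) auto
  then have card: "card C \<le> rank X"
    by (simp add: card_image[OF inj] rank_dim_range)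
  have "(norm X)\<^sup>2 = (\<Sum>b\<in>B. (norm (X *v b))\<^sup>2)"
    using matrix_inner_orthonormal[OF B(1-4), of X X] by (simp add: dot_square_norm)
  also have "\<dots> = (\<Sum>b\<in>C. (norm (X *v b))\<^sup>2)"
    using B(1) by (intro sum.mono_neutral_right) (auto simp: C_def)
  finally have fro: "(norm X)\<^sup>2 = (\<Sum>b\<in>C. (norm (X *v b))\<^sup>2)" .
  have "nuclear_norm X = (\<Sum>b\<in>C. norm (X *v b))"
    unfolding B(5) using B(1) by (intro sum.mono_neutral_right) (auto simp: C_def)
  moreover have "(\<Sum>b\<in>C. norm (X *v b))\<^sup>2 \<le> (norm X)\<^sup>2 * card C"
    using Cauchy_Schwarz_ineq_sum[of "\<lambda>b. norm (X *v b)" "\<lambda>_. 1" C] by (simp add: fro)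
  ultimately have "(nuclear_norm X)\<^sup>2 \<le> (norm X)\<^sup>2 * card C" by simp
  also have "\<dots> \<le> (sqrt (rank X) * norm X)\<^sup>2"
    using mult_left_mono[of "real (card C)" "rank X" "(norm X)\<^sup>2"] card
    by (simp add: power_mult_distrib ac_simps)
  finally show ?thesis
    by (rule power2_le_imp_le) simp
qed

section \<open>The standard Gaussian measure on a Euclidean space\<close>

abbreviation std_normal :: "real measure" where
  "std_normal \<equiv> density lborel (\<lambda>x. ennreal (std_normal_density x))"

lemma prob_space_std_normal: "prob_space std_normal"
  by (rule prob_space_normal_density) simp

text \<open>Rotation invariance in one dimension: \<open>s * x\<close> and \<open>t * y\<close> are
  independent normal variables whose variances \<open>s\<^sup>2\<close> and \<open>t\<^sup>2\<close>
  add up to 1. A vanishing weight is treated apart, since a constant has no normal density.\<close>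

lemma std_normal_combination:
  assumes st: "s \<ge> 0" "t \<ge> 0" "s\<^sup>2 + t\<^sup>2 = 1"
  shows "distr (std_normal \<Otimes>\<^sub>M std_normal) borel (\<lambda>(x, y). s * x + t * y) = std_normal"
proof -
  interpret N: prob_space std_normal by (rule prob_space_std_normal)
  interpret NN: pair_prob_space std_normal std_normal ..
  have fst: "distr (std_normal \<Otimes>\<^sub>M std_normal) borel fst = std_normal"
    using N.distr_pair_fst[of std_normal]
    by (metis (no_types, lifting) distr_cong sets_density sets_lborel)
  have "distr (std_normal \<Otimes>\<^sub>M std_normal) borel snd =
      distr (distr (std_normal \<Otimes>\<^sub>M std_normal) (std_normal \<Otimes>\<^sub>M std_normal) (\<lambda>(x, y). (y, x))) borel snd"
    using NN.distr_pair_swap by simp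
  also have "\<dots> = distr (std_normal \<Otimes>\<^sub>M std_normal) borel fst"
    by (subst distr_distr) (auto simp: comp_def split_beta')
  finally have snd: "distr (std_normal \<Otimes>\<^sub>M std_normal) borel snd = std_normal"
    using fst by simp
  have "distr (std_normal \<Otimes>\<^sub>M std_normal) (borel \<Otimes>\<^sub>M borel) (\<lambda>x. x) = std_normal \<Otimes>\<^sub>M std_normal"
    by (rule distr_id2) (simp add: borel_prod[symmetric] cong: sets_pair_measure_cong)
  then have ind: "NN.indep_var borel fst borel snd"
    unfolding NN.indep_var_distribution_eq fst snd by simp
  have d: "distributed (std_normal \<Otimes>\<^sub>M std_normal) lborel fst std_normal_density"
    "distributed (std_normal \<Otimes>\<^sub>M std_normal) lborel snd std_normal_density"
    using fst snd by (auto simp: distributed_def cong: distr_cong)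
  show ?thesis
  proof (cases "s = 0 \<or> t = 0")
    case True
    then show ?thesis
    proof
      assume "s = 0"
      then have "t = 1" using st by (simp add: power2_eq_1_iff)
      then show ?thesis using \<open>s = 0\<close> snd by (simp add: split_beta')
    next
      assume "t = 0"
      then have "s = 1" using st by (simp add: power2_eq_1_iff)
      then show ?thesis using \<open>t = 0\<close> fst by (simp add: split_beta')
    qed
  next
    case False
    have "NN.indep_var borel ((\<lambda>x. s * x) \<circ> fst) borel ((\<lambda>x. t * x) \<circ> snd)"
      by (rule NN.indep_var_compose[OF ind]) auto
    moreover have "distributed (std_normal \<Otimes>\<^sub>M std_normal) lborel ((\<lambda>x. s * x) \<circ> fst) (normal_density 0 s)"
      using NN.normal_density_affine[OF d(1), of s 0] False st by (simp add: comp_def)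
    moreover have "distributed (std_normal \<Otimes>\<^sub>M std_normal) lborel ((\<lambda>x. t * x) \<circ> snd) (normal_density 0 t)"
      using NN.normal_density_affine[OF d(2), of t 0] False st by (simp add: comp_def)
    ultimately have "distributed (std_normal \<Otimes>\<^sub>M std_normal) lborel
        (\<lambda>x. ((\<lambda>x. s * x) \<circ> fst) x + ((\<lambda>x. t * x) \<circ> snd) x) (normal_density (0 + 0) (sqrt (s\<^sup>2 + t\<^sup>2)))"
      using False st by (intro NN.add_indep_normal) (auto simp del: comp_apply)
    from distributed_distr_eq_density[OF this] show ?thesis
      using st by (simp add: split_beta' comp_def cong: distr_cong)
  qed
qed

text \<open>Available on every Euclidean space, it serves both for matrices, whose basis consists of
  the matrix units, and for pairs of vectors in the dominating process.\<close>

definition std_gaussian :: "'a::euclidean_space measure" where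
  "std_gaussian = distr (\<Pi>\<^sub>M b\<in>Basis. std_normal) borel (\<lambda>x. \<Sum>b\<in>Basis. x b *\<^sub>R b)"

lemma sets_std_gaussian [simp, measurable_cong]: "sets std_gaussian = sets borel"
  by (simp add: std_gaussian_def)

lemma space_std_gaussian [simp]: "space std_gaussian = UNIV"
  by (simp add: std_gaussian_def)

lemma prob_space_std_gaussian: "prob_space std_gaussian"
proof -
  interpret product_prob_space "\<lambda>_. std_normal" Basis
    by (simp add: prob_space_std_normal product_prob_space_def product_prob_space_axioms_def product_sigma_finite_def prob_space_imp_sigma_finite)
  show ?thesis
    unfolding std_gaussian_def by (rule prob_space_distr) simp
qed

text \<open>In coordinates, \<open>M\<close> agrees with the product measure on boxes and hence
  everywhere; mapping back through the basis expansion returns \<open>M\<close> on one side and the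
  definition of \<open>std_gaussian\<close> on the other.\<close>

lemma std_gaussian_eqI:
  fixes M :: "'a::euclidean_space measure"
  assumes sets: "sets M = sets borel"
    and box: "\<And>A. (\<And>b. A b \<in> sets borel) \<Longrightarrow>
      emeasure M {x. \<forall>b\<in>Basis. x \<bullet> b \<in> A b} = (\<Prod>b\<in>Basis. emeasure std_normal (A b))"
  shows "M = std_gaussian"
proof -
  interpret product_prob_space "\<lambda>_. std_normal" Basis
    by (simp add: prob_space_std_normal product_prob_space_def product_prob_space_axioms_def product_sigma_finite_def prob_space_imp_sigma_finite)
  let ?P = "\<Pi>\<^sub>M b\<in>(Basis :: 'a set). std_normal"
  have meas: "(\<lambda>x. \<lambda>b\<in>Basis. x \<bullet> b) \<in> M \<rightarrow>\<^sub>M ?P"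
    using sets by (intro measurable_restrict) (auto cong: measurable_cong_sets)
  have sp: "space M = UNIV" using sets_eq_imp_space_eq[OF sets] by simp
  have "distr M ?P (\<lambda>x. \<lambda>b\<in>Basis. x \<bullet> b) = ?P"
  proof (rule PiM_eqI)
    fix A :: "'a \<Rightarrow> real set" assume A: "\<And>b. b \<in> Basis \<Longrightarrow> A b \<in> sets std_normal"
    \<comment> \<open>Only the sets at indices in \<open>Basis\<close> are known to be Borel, while
      \<open>box\<close> asks for a Borel set at every index; the empty set fills the others and
      does not enter the box.\<close>
    let ?A = "\<lambda>b. if b \<in> Basis then A b else {}"
    have "emeasure (distr M ?P (\<lambda>x. \<lambda>b\<in>Basis. x \<bullet> b)) (Pi\<^sub>E Basis A) =
        emeasure M {x. \<forall>b\<in>Basis. x \<bullet> b \<in> A b}"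
      using A by (subst emeasure_distr[OF meas]) (auto intro!: arg_cong[where f="emeasure M"] sets_PiM_I_finite simp: sp PiE_iff)
    also have "\<dots> = emeasure M {x. \<forall>b\<in>Basis. x \<bullet> b \<in> ?A b}"
      by simp
    also have "\<dots> = (\<Prod>b\<in>Basis. emeasure std_normal (?A b))"
      using A by (intro box) auto
    finally show "emeasure (distr M ?P (\<lambda>x. \<lambda>b\<in>Basis. x \<bullet> b)) (Pi\<^sub>E Basis A) = (\<Prod>b\<in>Basis. emeasure std_normal (A b))"
      by simp
  qed simp_all
  then have "std_gaussian = distr (distr M ?P (\<lambda>x. \<lambda>b\<in>Basis. x \<bullet> b)) borel (\<lambda>x. \<Sum>b\<in>Basis. x b *\<^sub>R b)"
    by (simp add: std_gaussian_def)
  also have "\<dots> = distr M borel (\<lambda>x. \<Sum>b\<in>Basis. (x \<bullet> b) *\<^sub>R b)"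
    by (subst distr_distr[OF _ meas]) (auto simp: comp_def intro!: distr_cong)
  also have "\<dots> = M"
    using sets by (simp add: euclidean_representation distr_id2)
  finally show ?thesis ..
qed

text \<open>On a box the indicator is a product over coordinates, so Fubini reduces the claim to
  \<open>std_normal_combination\<close> in each coordinate. This stability allows a Gaussian vector
  to be split into independent pieces and independent ones to be merged.\<close>

lemma std_gaussian_combination:
  assumes st: "s \<ge> 0" "t \<ge> 0" "s\<^sup>2 + t\<^sup>2 = 1"
  shows "distr (std_gaussian \<Otimes>\<^sub>M std_gaussian) borel (\<lambda>(x, y). s *\<^sub>R x + t *\<^sub>R y)
    = (std_gaussian :: 'a::euclidean_space measure)"
proof (rule std_gaussian_eqI)
  interpret N: prob_space std_normal by (rule prob_space_std_normal)
  interpret P: product_prob_space "\<lambda>_. std_normal" Basis ..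
  interpret G: prob_space "std_gaussian :: 'a measure" by (rule prob_space_std_gaussian)
  let ?P = "\<Pi>\<^sub>M b\<in>(Basis :: 'a set). std_normal"
  have nn: "(\<integral>\<^sup>+x. (\<Prod>b\<in>Basis. f b (x \<bullet> b)) \<partial>std_gaussian) = (\<Prod>b\<in>(Basis::'a set). \<integral>\<^sup>+x. f b x \<partial>std_normal)"
    if [measurable]: "\<And>b. f b \<in> borel_measurable borel" for f :: "'a \<Rightarrow> real \<Rightarrow> ennreal"
  proof -
    have "(\<integral>\<^sup>+x. (\<Prod>b\<in>Basis. f b (x \<bullet> b)) \<partial>std_gaussian) =
        (\<integral>\<^sup>+x. (\<Prod>b\<in>Basis. f b ((\<Sum>c\<in>(Basis::'a set). x c *\<^sub>R c) \<bullet> b)) \<partial>?P)"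
      unfolding std_gaussian_def by (subst nn_integral_distr) auto
    also have "\<dots> = (\<integral>\<^sup>+x. (\<Prod>b\<in>(Basis::'a set). f b (x b)) \<partial>?P)"
      by (intro nn_integral_cong prod.cong) auto
    also have "\<dots> = (\<Prod>b\<in>(Basis::'a set). \<integral>\<^sup>+x. f b x \<partial>std_normal)"
      by (rule P.product_nn_integral_prod) auto
    finally show ?thesis .
  qed
  have one: "(\<integral>\<^sup>+x. \<integral>\<^sup>+y. indicator A (s * x + t * y) \<partial>std_normal \<partial>std_normal) = emeasure std_normal A"
    if [measurable]: "A \<in> sets borel" for A
  proof -
    have "(\<integral>\<^sup>+x. \<integral>\<^sup>+y. indicator A (s * x + t * y) \<partial>std_normal \<partial>std_normal) =
        (\<integral>\<^sup>+z. indicator A ((\<lambda>(x, y). s * x + t * y) z) \<partial>(std_normal \<Otimes>\<^sub>M std_normal))"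
      by (subst N.nn_integral_fst[symmetric]) auto
    also have "\<dots> = (\<integral>\<^sup>+z. indicator A z \<partial>distr (std_normal \<Otimes>\<^sub>M std_normal) borel (\<lambda>(x, y). s * x + t * y))"
      by (subst nn_integral_distr) auto
    finally show ?thesis
      using that by (simp add: std_normal_combination[OF st])
  qed
  fix A :: "'a \<Rightarrow> real set" assume [measurable]: "\<And>b. A b \<in> sets borel"
  have *: "indicator {x. \<forall>b\<in>Basis. x \<bullet> b \<in> A b} z = (\<Prod>b\<in>Basis. indicator (A b) (z \<bullet> b) :: ennreal)" for z
    by (auto simp: indicator_def prod_zero_iff split: if_splits)
  have [measurable]: "{x. \<forall>b\<in>Basis. x \<bullet> b \<in> A b} \<in> sets borel" by measurable
  have "emeasure (distr (std_gaussian \<Otimes>\<^sub>M std_gaussian) borel (\<lambda>(x, y). s *\<^sub>R x + t *\<^sub>R y)) {x. \<forall>b\<in>Basis. x \<bullet> b \<in> A b}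
      = (\<integral>\<^sup>+z. indicator {x. \<forall>b\<in>Basis. x \<bullet> b \<in> A b} z \<partial>distr (std_gaussian \<Otimes>\<^sub>M std_gaussian) borel (\<lambda>(x, y). s *\<^sub>R x + t *\<^sub>R y))"
    by simp
  also have "\<dots> = (\<integral>\<^sup>+z. indicator {x. \<forall>b\<in>Basis. x \<bullet> b \<in> A b} ((\<lambda>(x, y). s *\<^sub>R x + t *\<^sub>R y) z) \<partial>(std_gaussian \<Otimes>\<^sub>M std_gaussian))"
    by (subst nn_integral_distr) auto
  also have "\<dots> = (\<integral>\<^sup>+x. \<integral>\<^sup>+y. (\<Prod>b\<in>Basis. indicator (A b) (s * (x \<bullet> b) + t * (y \<bullet> b))) \<partial>std_gaussian \<partial>std_gaussian)"
    unfolding * by (subst G.nn_integral_fst[symmetric]) (auto simp: inner_add_left)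
  also have "\<dots> = (\<integral>\<^sup>+x. (\<Prod>b\<in>Basis. \<integral>\<^sup>+y. indicator (A b) (s * (x \<bullet> b) + t * y) \<partial>std_normal) \<partial>std_gaussian)"
    by (intro nn_integral_cong nn) measurable
  also have "\<dots> = (\<Prod>b\<in>Basis. \<integral>\<^sup>+x. \<integral>\<^sup>+y. indicator (A b) (s * x + t * y) \<partial>std_normal \<partial>std_normal)"
    by (intro nn) measurable
  finally show "emeasure (distr (std_gaussian \<Otimes>\<^sub>M std_gaussian) borel (\<lambda>(x, y). s *\<^sub>R x + t *\<^sub>R y)) {x. \<forall>b\<in>Basis. x \<bullet> b \<in> A b}
      = (\<Prod>b\<in>Basis. emeasure std_normal (A b))"
    by (simp add: one)
qed simp

lemma (in prob_space) distr_std_gaussianI: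
  fixes G :: "'a \<Rightarrow> 'b::euclidean_space"
  assumes ind: "indep_vars (\<lambda>_. borel) (\<lambda>b \<omega>. G \<omega> \<bullet> b) Basis"
    and d: "\<And>b. b \<in> Basis \<Longrightarrow> distributed M lborel (\<lambda>\<omega>. G \<omega> \<bullet> b) std_normal_density"
  shows "G \<in> borel_measurable M" "distr M borel G = std_gaussian"
proof -
  have m: "(\<lambda>\<omega>. G \<omega> \<bullet> b) \<in> borel_measurable M" if "b \<in> Basis" for b
    using ind that by (auto simp: indep_vars_def)
  then show G [measurable]: "G \<in> borel_measurable M"
    by (simp add: borel_measurable_euclidean_space[where f=G])
  show "distr M borel G = std_gaussian"
  proof (rule std_gaussian_eqI)
    fix A :: "'b \<Rightarrow> real set" assume [measurable]: "\<And>b. A b \<in> sets borel"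
    have "emeasure (distr M borel G) {x. \<forall>b\<in>Basis. x \<bullet> b \<in> A b} = emeasure M (\<Inter>b\<in>Basis. (\<lambda>\<omega>. G \<omega> \<bullet> b) -` A b \<inter> space M)"
      by (subst emeasure_distr) (auto intro!: arg_cong[where f="emeasure M"])
    also have "\<dots> = ennreal (\<Prod>b\<in>Basis. prob ((\<lambda>\<omega>. G \<omega> \<bullet> b) -` A b \<inter> space M))"
      using indep_varsD_finite[OF ind, of "\<lambda>b. A b"] by (simp add: emeasure_eq_measure)
    also have "\<dots> = (\<Prod>b\<in>Basis. emeasure (distr M lborel (\<lambda>\<omega>. G \<omega> \<bullet> b)) (A b))"
      using m by (auto simp: prod_ennreal[symmetric] emeasure_distr emeasure_eq_measure intro!: prod.cong)
    also have "\<dots> = (\<Prod>b\<in>Basis. emeasure std_normal (A b))"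
      using distributed_distr_eq_density[OF d] by (intro prod.cong) auto
    finally show "emeasure (distr M borel G) {x. \<forall>b\<in>Basis. x \<bullet> b \<in> A b} = (\<Prod>b\<in>Basis. emeasure std_normal (A b))" .
  qed simp
qed

section \<open>Laws and moments of coordinates, linear functionals and the norm\<close>

lemma std_gaussian_coordinates:
  "prob_space.indep_vars std_gaussian (\<lambda>_. borel) (\<lambda>b x. x \<bullet> b) (Basis :: 'a::euclidean_space set)"
  and distributed_std_gaussian_Basis: "b \<in> Basis \<Longrightarrow> distributed std_gaussian lborel (\<lambda>x :: 'a. x \<bullet> b) std_normal_density"
proof -
  interpret N: prob_space std_normal by (rule prob_space_std_normal)
  interpret P: product_prob_space "\<lambda>_. std_normal" Basis ..
  interpret G: prob_space "std_gaussian :: 'a measure" by (rule prob_space_std_gaussian)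
  let ?P = "\<Pi>\<^sub>M b\<in>(Basis :: 'a set). std_normal"
  have d: "distr std_gaussian borel (\<lambda>x. x \<bullet> b) = std_normal" if b: "b \<in> Basis" for b :: 'a
  proof -
    have "distr std_gaussian borel (\<lambda>x. x \<bullet> b) = distr ?P borel (\<lambda>x. (\<Sum>c\<in>Basis. x c *\<^sub>R c) \<bullet> b)"
      unfolding std_gaussian_def by (subst distr_distr) (auto simp: comp_def)
    also have "\<dots> = distr ?P std_normal (\<lambda>x. x b)"
      using b by (intro distr_cong) (auto simp: inner_sum_left_Basis)
    also have "\<dots> = std_normal"
      using b by (rule P.PiM_component)
    finally show ?thesis .
  qed
  then show "distributed std_gaussian lborel (\<lambda>x. x \<bullet> b) std_normal_density" if "b \<in> Basis" for b :: 'a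
    using that by (auto simp: distributed_def cong: distr_cong)
  have "distr std_gaussian (\<Pi>\<^sub>M b\<in>(Basis :: 'a set). borel) (\<lambda>x. \<lambda>b\<in>Basis. x \<bullet> b) =
      distr ?P (\<Pi>\<^sub>M b\<in>(Basis :: 'a set). borel) (\<lambda>x. \<lambda>b\<in>Basis. (\<Sum>c\<in>(Basis::'a set). x c *\<^sub>R c) \<bullet> b)"
    unfolding std_gaussian_def by (subst distr_distr) (auto simp: comp_def)
  also have "\<dots> = distr ?P ?P (\<lambda>x. x)"
  proof (rule distr_cong)
    show "(\<lambda>b\<in>Basis. (\<Sum>c\<in>(Basis::'a set). x c *\<^sub>R c) \<bullet> b) = x" if "x \<in> space ?P" for x
      using that by (auto simp: fun_eq_iff space_PiM PiE_def extensional_def)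
  qed (auto intro!: sets_PiM_cong)
  also have "\<dots> = (\<Pi>\<^sub>M b\<in>(Basis :: 'a set). distr std_gaussian borel (\<lambda>x. x \<bullet> b))"
    using d by (simp add: distr_id cong: PiM_cong)
  finally show "G.indep_vars (\<lambda>_. borel) (\<lambda>b x. x \<bullet> b) (Basis :: 'a::euclidean_space set)"
    by (subst G.indep_vars_iff_distr_eq_PiM') auto
qed

lemma distributed_std_gaussian_inner:
  fixes h :: "'a::euclidean_space"
  assumes "h \<noteq> 0"
  shows "distributed std_gaussian lborel (\<lambda>x. x \<bullet> h) (normal_density 0 (norm h))"
proof -
  interpret G: prob_space "std_gaussian :: 'a measure" by (rule prob_space_std_gaussian)
  \<comment> \<open>Coordinates with zero coefficient are left out, because the sum rule for
    independent normal variables asks for positive standard deviations.\<close>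
  let ?I = "{b \<in> Basis. h \<bullet> b \<noteq> 0}"
  have ne: "?I \<noteq> {}"
    using assms euclidean_all_zero_iff[of h] by auto
  have ind: "G.indep_vars (\<lambda>_. borel) (\<lambda>b x. 0 + (h \<bullet> b) * (x \<bullet> b)) ?I"
    by (rule G.indep_vars_compose2[OF G.indep_vars_subset[OF std_gaussian_coordinates]]) auto
  have "distributed std_gaussian lborel (\<lambda>x. \<Sum>b\<in>?I. 0 + (h \<bullet> b) * (x \<bullet> b))
      (normal_density (\<Sum>b\<in>?I. 0) (sqrt (\<Sum>b\<in>?I. (\<bar>h \<bullet> b\<bar>)\<^sup>2)))"
    using G.normal_density_affine[OF distributed_std_gaussian_Basis, of _ _ 0]
    by (intro G.sum_indep_normal[OF _ ne ind]) auto
  moreover have "(\<Sum>b\<in>?I. 0 + (h \<bullet> b) * (x \<bullet> b)) = x \<bullet> h" for x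
    by (subst euclidean_inner) (auto intro!: sum.mono_neutral_cong_left)
  moreover have "sqrt (\<Sum>b\<in>?I. (\<bar>h \<bullet> b\<bar>)\<^sup>2) = norm h"
    unfolding norm_eq_sqrt_inner
    by (subst euclidean_inner) (auto intro!: sum.mono_neutral_cong_left simp: power2_eq_square)
  ultimately show ?thesis by simp
qed

text \<open>The absolute first moment is the origin of \<open>sqrt (2 / pi)\<close>. The first two
  moments evaluate the second-order expansion of log-sum-exp, and third absolute moments bound its
  error. The vector \<open>h = 0\<close> is a separate case because its functional has no
  density.\<close>

lemma std_gaussian_moments:
  fixes h :: "'a::euclidean_space"
  shows std_gaussian_moment_1: "has_bochner_integral std_gaussian (\<lambda>x. x \<bullet> h) 0"
    and std_gaussian_abs_moment_1: "has_bochner_integral std_gaussian (\<lambda>x. \<bar>x \<bullet> h\<bar>) (sqrt (2 / pi) * norm h)"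
    and std_gaussian_moment_2: "has_bochner_integral std_gaussian (\<lambda>x. (x \<bullet> h)\<^sup>2) ((norm h)\<^sup>2)"
    and integrable_std_gaussian_abs_moment: "integrable std_gaussian (\<lambda>x. \<bar>x \<bullet> h\<bar> ^ k)"
proof -
  interpret G: prob_space "std_gaussian :: 'a measure" by (rule prob_space_std_gaussian)
  have *: "has_bochner_integral std_gaussian (\<lambda>x. f (x \<bullet> h)) c"
    if "has_bochner_integral lborel (\<lambda>x. normal_density 0 (norm h) x * f x) c" "f \<in> borel_measurable borel" "h \<noteq> 0"
    for f :: "real \<Rightarrow> real" and c
    using that distributed_integrable[OF distributed_std_gaussian_inner[OF that(3)], of f]
      distributed_integral[OF distributed_std_gaussian_inner[OF that(3)], of f]
    by (auto simp: has_bochner_integral_iff)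
  show "has_bochner_integral std_gaussian (\<lambda>x. x \<bullet> h) 0"
  proof (cases "h = 0")
    case False
    then show ?thesis using *[of "\<lambda>x. x" 0] normal_moment_odd[of "norm h" 0 0] by simp
  qed (auto intro: has_bochner_integral_zero)
  show "has_bochner_integral std_gaussian (\<lambda>x. \<bar>x \<bullet> h\<bar>) (sqrt (2 / pi) * norm h)"
  proof (cases "h = 0")
    case False
    then show ?thesis using *[of "\<lambda>x. \<bar>x\<bar>"] normal_moment_abs_odd[of "norm h" 0 0] by (simp add: mult.commute)
  qed (auto intro: has_bochner_integral_zero)
  show "has_bochner_integral std_gaussian (\<lambda>x. (x \<bullet> h)\<^sup>2) ((norm h)\<^sup>2)"
  proof (cases "h = 0")
    case False
    then show ?thesis using *[of "\<lambda>x. x\<^sup>2"] normal_moment_even[of "norm h" 0 1] by simp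
  qed (auto intro: has_bochner_integral_zero)
  show "integrable std_gaussian (\<lambda>x. \<bar>x \<bullet> h\<bar> ^ k)"
  proof (cases "h = 0")
    case False
    then show ?thesis
      using distributed_integrable[OF distributed_std_gaussian_inner[OF False], of "\<lambda>x. \<bar>x\<bar> ^ k"]
        integrable_normal_moment_abs[of "norm h" 0 k] by simp
  qed auto
qed

lemma std_gaussian_norm_square: "has_bochner_integral std_gaussian (\<lambda>x :: 'a::euclidean_space. (norm x)\<^sup>2) DIM('a)"
proof -
  have "has_bochner_integral std_gaussian (\<lambda>x :: 'a. \<Sum>b\<in>Basis. (x \<bullet> b)\<^sup>2) (\<Sum>b\<in>(Basis :: 'a set). (norm b)\<^sup>2)"
    by (intro has_bochner_integral_sum std_gaussian_moment_2)
  then show ?thesis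
    by (simp add: norm_eq_sqrt_inner euclidean_inner[symmetric] power2_eq_square)
qed

text \<open>Nonnegativity of the variance bounds the square of the mean norm by the mean square,
  which is the dimension.\<close>

lemma std_gaussian_norm:
  "integrable std_gaussian (norm :: 'a::euclidean_space \<Rightarrow> real)"
  "(\<integral>x. norm x \<partial>(std_gaussian :: 'a measure)) \<le> sqrt DIM('a)"
proof -
  interpret G: prob_space "std_gaussian :: 'a measure" by (rule prob_space_std_gaussian)
  have 2: "integrable std_gaussian (\<lambda>x :: 'a. (norm x)\<^sup>2)" "(\<integral>x. (norm x)\<^sup>2 \<partial>(std_gaussian :: 'a measure)) = DIM('a)"
    using std_gaussian_norm_square by (auto simp: has_bochner_integral_iff)
  show i: "integrable std_gaussian (norm :: 'a \<Rightarrow> real)"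
    by (rule G.square_integrable_imp_integrable) (use 2 in auto)
  have "(\<integral>x. norm x \<partial>(std_gaussian :: 'a measure))\<^sup>2 \<le> (\<integral>x. (norm x)\<^sup>2 \<partial>(std_gaussian :: 'a measure))"
    using G.variance_eq[OF i 2(1)] G.variance_positive[of norm] by linarith
  then show "(\<integral>x. norm x \<partial>(std_gaussian :: 'a measure)) \<le> sqrt DIM('a)"
    using 2(2) real_le_rsqrt by metis
qed

lemma distr_std_gaussian_uminus: "distr std_gaussian borel uminus = (std_gaussian :: 'a::euclidean_space measure)"
proof -
  interpret G: prob_space "std_gaussian :: 'a measure" by (rule prob_space_std_gaussian)
  have "G.indep_vars (\<lambda>_. borel) (\<lambda>b x. - (x \<bullet> b)) Basis"
    by (rule G.indep_vars_compose2[OF std_gaussian_coordinates]) auto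
  moreover have "distributed std_gaussian lborel (\<lambda>x :: 'a. - (x \<bullet> b)) std_normal_density" if "b \<in> Basis" for b
    using G.normal_density_affine[OF distributed_std_gaussian_Basis[OF that], of "-1" 0] by simp
  ultimately show ?thesis
    by (intro G.distr_std_gaussianI) simp_all
qed

section \<open>The Sudakov--Fernique inequality\<close>

definition log_sum_exp :: "'i set \<Rightarrow> ('i \<Rightarrow> real) \<Rightarrow> real" where
  "log_sum_exp I x = ln (\<Sum>i\<in>I. exp (x i))"

text \<open>Along the line \<open>x i + \<tau> * z i\<close>, the derivatives of log-sum-exp in
  \<tau> are the cumulants of \<open>z\<close> under weights proportional to
  \<open>exp (x i + \<tau> * z i)\<close>. At 0 the first two are the weighted mean and variance;
  the third bounds the remainder.\<close>

lemma log_sum_exp_taylor: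
  fixes x z :: "'i \<Rightarrow> real"
  assumes I: "finite I" "I \<noteq> {}" and Z: "\<And>i. i \<in> I \<Longrightarrow> \<bar>z i\<bar> \<le> Z"
    and w: "\<And>i. w i = exp (x i) / (\<Sum>j\<in>I. exp (x j))"
  shows "\<bar>log_sum_exp I (\<lambda>i. x i + z i) -
      (log_sum_exp I x + (\<Sum>i\<in>I. w i * z i) + ((\<Sum>i\<in>I. w i * (z i)\<^sup>2) - (\<Sum>i\<in>I. w i * z i)\<^sup>2) / 2)\<bar> \<le> Z ^ 3"
proof -
  define m where "m k \<tau> = (\<Sum>i\<in>I. z i ^ k * exp (x i + \<tau> * z i))" for k :: nat and \<tau> :: real
  have Z0: "Z \<ge> 0" using I Z by fastforce
  have pos: "m 0 \<tau> > 0" for \<tau>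
    using I by (auto simp: m_def intro!: sum_pos)
  have D: "(m k has_real_derivative m (Suc k) \<tau>) (at \<tau>)" for k \<tau>
    unfolding m_def by (auto intro!: derivative_eq_intros sum.cong simp: algebra_simps)
  define \<mu> where "\<mu> k \<tau> = m k \<tau> / m 0 \<tau>" for k \<tau>
  have D\<mu>: "(\<mu> k has_real_derivative \<mu> (Suc k) \<tau> - \<mu> k \<tau> * \<mu> 1 \<tau>) (at \<tau>)" for k \<tau>
  proof -
    have "(\<mu> k has_real_derivative (m (Suc k) \<tau> * m 0 \<tau> - m k \<tau> * m (Suc 0) \<tau>) / (m 0 \<tau> * m 0 \<tau>)) (at \<tau>)"
      unfolding \<mu>_def[abs_def] using pos[of \<tau>] by (intro DERIV_divide D) simp
    moreover have "(m (Suc k) \<tau> * m 0 \<tau> - m k \<tau> * m (Suc 0) \<tau>) / (m 0 \<tau> * m 0 \<tau>) = \<mu> (Suc k) \<tau> - \<mu> k \<tau> * \<mu> 1 \<tau>"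
      using pos[of \<tau>] by (simp add: \<mu>_def field_simps)
    ultimately show ?thesis by simp
  qed
  have bound: "\<bar>\<mu> k \<tau>\<bar> \<le> Z ^ k" for k \<tau>
  proof -
    have "\<bar>m k \<tau>\<bar> \<le> (\<Sum>i\<in>I. \<bar>z i ^ k * exp (x i + \<tau> * z i)\<bar>)"
      unfolding m_def by (rule sum_abs)
    also have "\<dots> \<le> (\<Sum>i\<in>I. Z ^ k * exp (x i + \<tau> * z i))"
      using Z by (intro sum_mono) (auto simp: abs_mult power_abs intro!: mult_right_mono power_mono)
    also have "\<dots> = Z ^ k * m 0 \<tau>" by (simp add: m_def sum_distrib_left)
    finally show ?thesis using pos[of \<tau>] by (simp add: \<mu>_def divide_le_eq)
  qed
  \<comment> \<open>The function itself and its first three cumulants, written in the normalized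
    moments \<open>\<mu> k\<close>; the catch-all branch is the third cumulant, used at
    \<open>k = 3\<close>.\<close>
  define diff where "diff k = (case k of 0 \<Rightarrow> (\<lambda>\<tau>. ln (m 0 \<tau>)) | Suc 0 \<Rightarrow> \<mu> 1
    | Suc (Suc 0) \<Rightarrow> (\<lambda>\<tau>. \<mu> 2 \<tau> - (\<mu> 1 \<tau>)\<^sup>2)
    | _ \<Rightarrow> (\<lambda>\<tau>. \<mu> 3 \<tau> - \<mu> 2 \<tau> * \<mu> 1 \<tau> - 2 * \<mu> 1 \<tau> * (\<mu> 2 \<tau> - (\<mu> 1 \<tau>)\<^sup>2)))" for k :: nat
  have "\<exists>t>0. t < 1 \<and> ln (m 0 1) = (\<Sum>k<3. diff k 0 / fact k * 1 ^ k) + diff 3 t / fact 3 * 1 ^ 3"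
  proof (rule Maclaurin)
    show "\<forall>k t. k < 3 \<and> 0 \<le> t \<and> t \<le> 1 \<longrightarrow> DERIV (diff k) t :> diff (Suc k) t"
    proof (intro allI impI)
      fix k :: nat and t :: real
      assume "k < 3 \<and> 0 \<le> t \<and> t \<le> 1"
      then consider "k = 0" | "k = 1" | "k = 2" by linarith
      then show "DERIV (diff k) t :> diff (Suc k) t"
      proof cases
        case 1
        have "((\<lambda>\<tau>. ln (m 0 \<tau>)) has_real_derivative \<mu> 1 t) (at t)"
          using pos[of t] D[of 0 t] by (auto intro!: derivative_eq_intros simp: \<mu>_def)
        then show ?thesis by (simp add: 1 diff_def)
      next
        case 2
        have "(\<mu> 1 has_real_derivative \<mu> 2 t - (\<mu> 1 t)\<^sup>2) (at t)"
          using D\<mu>[of 1 t] by (simp add: numeral_2_eq_2 power2_eq_square)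
        then show ?thesis by (simp add: 2 diff_def)
      next
        case 3
        have "((\<lambda>\<tau>. \<mu> 2 \<tau> - (\<mu> 1 \<tau>)\<^sup>2) has_real_derivative
            \<mu> 3 t - \<mu> 2 t * \<mu> 1 t - 2 * \<mu> 1 t * (\<mu> 2 t - (\<mu> 1 t)\<^sup>2)) (at t)"
          using D\<mu>[of 1 t] D\<mu>[of 2 t]
          by (auto intro!: derivative_eq_intros simp: numeral_2_eq_2 numeral_3_eq_3 power2_eq_square)
        then show ?thesis by (simp add: 3 diff_def numeral_2_eq_2)
      qed
    qed
  qed (auto simp: diff_def)
  then obtain t where "ln (m 0 1) = (\<Sum>k<3. diff k 0 / fact k * 1 ^ k) + diff 3 t / fact 3 * 1 ^ 3"
    by blast
  then have A: "ln (m 0 1) = diff 0 0 + diff 1 0 + diff 2 0 / 2 + diff 3 t / 6"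
    by (simp add: eval_nat_numeral)
  \<comment> \<open>The three parts of the third cumulant contribute \<open>1 + 1 + 4\<close> times
    \<open>Z ^ 3\<close>, and this 6 cancels the factorial in the Taylor remainder.\<close>
  have B: "\<bar>diff 3 t\<bar> \<le> 6 * Z ^ 3"
  proof -
    have "\<bar>\<mu> 2 t * \<mu> 1 t\<bar> \<le> Z ^ 2 * Z ^ 1"
      unfolding abs_mult using Z0 by (intro mult_mono bound) auto
    moreover have "\<bar>\<mu> 1 t * (\<mu> 2 t - (\<mu> 1 t)\<^sup>2)\<bar> \<le> Z ^ 1 * (Z ^ 2 + Z ^ 2)"
    proof -
      have "\<bar>(\<mu> 1 t)\<^sup>2\<bar> \<le> Z\<^sup>2"
        using power_mono[OF bound[of 1 t], of 2] by simp
      with bound[of 2 t] have "\<bar>\<mu> 2 t - (\<mu> 1 t)\<^sup>2\<bar> \<le> Z ^ 2 + Z ^ 2" by linarith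
      then show ?thesis
        unfolding abs_mult using Z0 by (intro mult_mono bound) auto
    qed
    moreover have "Z ^ 2 * Z ^ 1 = Z ^ 3" "Z ^ 1 * (Z ^ 2 + Z ^ 2) = 2 * Z ^ 3"
      by (auto simp: power2_eq_square power3_eq_cube)
    moreover have "diff 3 t = \<mu> 3 t - \<mu> 2 t * \<mu> 1 t - 2 * (\<mu> 1 t * (\<mu> 2 t - (\<mu> 1 t)\<^sup>2))"
      by (simp add: diff_def numeral_3_eq_3)
    ultimately show ?thesis using bound[of 3 t] by linarith
  qed
  have C: "diff 0 0 = log_sum_exp I x" "ln (m 0 1) = log_sum_exp I (\<lambda>i. x i + z i)"
    by (simp_all add: diff_def m_def log_sum_exp_def)
  have \<mu>0: "\<mu> k 0 = (\<Sum>i\<in>I. w i * z i ^ k)" for k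
    by (simp add: \<mu>_def m_def w sum_divide_distrib mult.commute)
  have D: "diff 1 0 = (\<Sum>i\<in>I. w i * z i)" "diff 2 0 = (\<Sum>i\<in>I. w i * (z i)\<^sup>2) - (\<Sum>i\<in>I. w i * z i)\<^sup>2"
    using \<mu>0[of 1] \<mu>0[of 2] by (simp_all add: diff_def numeral_2_eq_2)
  have gen: "\<bar>l - (a + b + c / 2)\<bar> \<le> e"
    if "l = d0 + d1 + d2 / 2 + d / 6" "\<bar>d\<bar> \<le> 6 * e" "d0 = a" "d1 = b" "d2 = c" for l a b c d e d0 d1 d2 :: real
    using that by linarith
  show ?thesis using gen[OF A B C(1) D] by (simp only: C(2))
qed

text \<open>A perturbation \<open>z\<close> multiplies each exponential by at most
  \<open>exp (\<Sum>i\<in>I. \<bar>z i\<bar>)\<close>. The linear growth that follows is the source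
  of integrability under Gaussian measures.\<close>

lemma log_sum_exp_lipschitz:
  assumes I: "finite I" "I \<noteq> {}"
  shows "\<bar>log_sum_exp I (\<lambda>i. x i + z i) - log_sum_exp I x\<bar> \<le> (\<Sum>i\<in>I. \<bar>z i\<bar>)"
proof -
  have *: "log_sum_exp I (\<lambda>i. x i + z i) \<le> log_sum_exp I x + (\<Sum>i\<in>I. \<bar>z i\<bar>)" for x z
  proof -
    have "(\<Sum>i\<in>I. exp (x i + z i)) \<le> (\<Sum>i\<in>I. exp (x i) * exp (\<Sum>i\<in>I. \<bar>z i\<bar>))"
    proof (rule sum_mono)
      fix i assume "i \<in> I"
      then have "z i \<le> (\<Sum>i\<in>I. \<bar>z i\<bar>)"
        using member_le_sum[of i I "\<lambda>i. \<bar>z i\<bar>"] I by auto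
      then show "exp (x i + z i) \<le> exp (x i) * exp (\<Sum>i\<in>I. \<bar>z i\<bar>)"
        by (simp add: exp_add[symmetric])
    qed
    moreover have "(\<Sum>i\<in>I. exp (x i + z i)) > 0" "(\<Sum>i\<in>I. exp (x i)) > 0"
      using I by (auto intro!: sum_pos)
    ultimately have "ln (\<Sum>i\<in>I. exp (x i + z i)) \<le> ln ((\<Sum>i\<in>I. exp (x i)) * exp (\<Sum>i\<in>I. \<bar>z i\<bar>))"
      by (subst ln_le_cancel_iff) (auto simp: sum_distrib_right)
    also have "\<dots> = ln (\<Sum>i\<in>I. exp (x i)) + (\<Sum>i\<in>I. \<bar>z i\<bar>)"
      using \<open>(\<Sum>i\<in>I. exp (x i)) > 0\<close> by (subst ln_mult) auto
    finally show ?thesis by (simp add: log_sum_exp_def)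
  qed
  from *[of x z] *[of "\<lambda>i. x i + z i" "\<lambda>i. - z i"] show ?thesis by simp
qed

lemma Max_le_log_sum_exp:
  assumes I: "finite I" "I \<noteq> {}"
  shows "Max (x ` I) \<le> log_sum_exp I x" "log_sum_exp I x \<le> Max (x ` I) + ln (card I)"
proof -
  obtain k where k: "k \<in> I" "x k = Max (x ` I)"
    using Max_in[of "x ` I"] I by (metis (mono_tags) finite_imageI image_iff image_is_empty)
  have pos: "(\<Sum>i\<in>I. exp (x i)) > 0" using I by (auto intro!: sum_pos)
  have "exp (x k) \<le> (\<Sum>i\<in>I. exp (x i))" using k I by (intro member_le_sum) auto
  then show "Max (x ` I) \<le> log_sum_exp I x"
    using pos by (simp add: log_sum_exp_def k(2)[symmetric] ln_ge_iff)
  have "(\<Sum>i\<in>I. exp (x i)) \<le> (\<Sum>i\<in>I. exp (Max (x ` I)))"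
    using I by (intro sum_mono) auto
  then have "log_sum_exp I x \<le> ln (card I * exp (Max (x ` I)))"
    unfolding log_sum_exp_def using pos by (subst ln_le_cancel_iff) auto
  also have "\<dots> = Max (x ` I) + ln (card I)"
    using I by (subst ln_mult) (auto simp: card_gt_0_iff)
  finally show "log_sum_exp I x \<le> Max (x ` I) + ln (card I)" .
qed

text \<open>The variance is half the mean squared distance of two independent draws with weights
  \<open>w\<close>. This expresses the second-order term through distances between points, the
  quantities that the comparison orders.\<close>

lemma weighted_variance:
  fixes v :: "'i \<Rightarrow> 'a::real_inner"
  assumes "finite I" "(\<Sum>i\<in>I. w i) = 1"
  shows "(\<Sum>i\<in>I. w i * (norm (v i))\<^sup>2) - (norm (\<Sum>i\<in>I. w i *\<^sub>R v i))\<^sup>2 =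
    (\<Sum>i\<in>I. \<Sum>j\<in>I. w i * w j * (norm (v i - v j))\<^sup>2) / 2"
proof -
  have "(\<Sum>i\<in>I. \<Sum>j\<in>I. w i * w j * (norm (v i - v j))\<^sup>2) =
      (\<Sum>i\<in>I. \<Sum>j\<in>I. w i * w j * (norm (v i))\<^sup>2) + (\<Sum>i\<in>I. \<Sum>j\<in>I. w i * w j * (norm (v j))\<^sup>2)
      - 2 * (\<Sum>i\<in>I. \<Sum>j\<in>I. w i * w j * (v i \<bullet> v j))"
    by (simp add: power2_norm_eq_inner inner_diff inner_commute algebra_simps sum.distrib sum_subtractf sum_distrib_left)
  also have "(\<Sum>i\<in>I. \<Sum>j\<in>I. w i * w j * (norm (v i))\<^sup>2) = (\<Sum>i\<in>I. w i * (norm (v i))\<^sup>2)"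
    using assms(2) by (simp add: sum_distrib_right[symmetric] sum_distrib_left[symmetric])
  also have "(\<Sum>i\<in>I. \<Sum>j\<in>I. w i * w j * (norm (v j))\<^sup>2) = (\<Sum>j\<in>I. w j * (norm (v j))\<^sup>2)"
    using assms(2) by (subst sum.swap) (simp add: mult.assoc sum_distrib_right[symmetric])
  also have "(\<Sum>i\<in>I. \<Sum>j\<in>I. w i * w j * (v i \<bullet> v j)) = (norm (\<Sum>i\<in>I. w i *\<^sub>R v i))\<^sup>2"
    by (simp add: power2_norm_eq_inner inner_sum_left inner_sum_right sum_distrib_left mult.assoc) (simp add: inner_commute)
  finally show ?thesis by simp
qed

section \<open>Gaussian integrals of functions of linear growth\<close>

lemma integrable_std_gaussian_linear_growth:
  fixes f :: "'a::euclidean_space \<Rightarrow> real"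
  assumes [measurable]: "f \<in> borel_measurable borel" and "\<And>x. \<bar>f x\<bar> \<le> K * (1 + norm x)"
  shows "integrable std_gaussian f"
proof (rule Bochner_Integration.integrable_bound)
  interpret G: prob_space "std_gaussian :: 'a measure" by (rule prob_space_std_gaussian)
  show "integrable std_gaussian (\<lambda>x :: 'a. K * (1 + norm x))"
    using std_gaussian_norm(1) by auto
  show "AE x in std_gaussian. norm (f x) \<le> norm (K * (1 + norm x))"
    using order_trans[OF assms(2) abs_ge_self] by simp
qed auto

lemma integrable_std_gaussian_pair_linear_growth:
  fixes f :: "'a::euclidean_space \<times> 'b::euclidean_space \<Rightarrow> real"
  assumes [measurable]: "f \<in> borel_measurable (borel \<Otimes>\<^sub>M borel)"
    and le: "\<And>x y. \<bar>f (x, y)\<bar> \<le> K * (1 + norm x + norm y)"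
  shows "integrable (std_gaussian \<Otimes>\<^sub>M std_gaussian) f"
proof -
  interpret A: prob_space "std_gaussian :: 'a measure" by (rule prob_space_std_gaussian)
  interpret B: prob_space "std_gaussian :: 'b measure" by (rule prob_space_std_gaussian)
  interpret AB: pair_prob_space "std_gaussian :: 'a measure" "std_gaussian :: 'b measure" ..
  show ?thesis
  proof (rule Bochner_Integration.integrable_bound)
    have 1: "integrable (std_gaussian \<Otimes>\<^sub>M std_gaussian) (\<lambda>z :: 'a \<times> 'b. 1 + norm (fst z) + norm (snd z))"
    proof (intro Bochner_Integration.integrable_add)
      show "integrable (std_gaussian \<Otimes>\<^sub>M std_gaussian) (\<lambda>z :: 'a \<times> 'b. norm (fst z))"
        by (rule AB.Fubini_integrable) (auto simp: std_gaussian_norm)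
      show "integrable (std_gaussian \<Otimes>\<^sub>M std_gaussian) (\<lambda>z :: 'a \<times> 'b. norm (snd z))"
        by (rule AB.Fubini_integrable) (auto simp: std_gaussian_norm)
    qed simp
    then show "integrable (std_gaussian \<Otimes>\<^sub>M std_gaussian) (\<lambda>z :: 'a \<times> 'b. K * (1 + norm (fst z) + norm (snd z)))"
      by (rule integrable_mult_right)
    show "AE z in std_gaussian \<Otimes>\<^sub>M std_gaussian. norm (f z) \<le> norm (K * (1 + norm (fst z) + norm (snd z)))"
      using order_trans[OF le abs_ge_self] by auto
  qed auto
qed

text \<open>The vectors \<open>c *\<^sub>R x\<close> and
  \<open>a *\<^sub>R x + u *\<^sub>R y\<close> have the same law by
  \<open>std_gaussian_combination\<close> with weights \<open>a / c\<close> and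
  \<open>u / c\<close>, which is why \<open>c = 0\<close> is a separate case; linear growth permits
  Fubini.\<close>

lemma std_gaussian_integral_split:
  fixes f :: "'a::euclidean_space \<Rightarrow> real"
  assumes [measurable]: "f \<in> borel_measurable borel" and le: "\<And>x. \<bar>f x\<bar> \<le> K * (1 + norm x)"
    and c: "c \<ge> 0" "a \<ge> 0" "u \<ge> 0" "c\<^sup>2 = a\<^sup>2 + u\<^sup>2"
  shows "(\<integral>x. f (c *\<^sub>R x) \<partial>std_gaussian) = (\<integral>x. \<integral>y. f (a *\<^sub>R x + u *\<^sub>R y) \<partial>std_gaussian \<partial>std_gaussian)"
proof (cases "c = 0")
  case True
  interpret A: prob_space "std_gaussian :: 'a measure" by (rule prob_space_std_gaussian)
  from True c have "a = 0" "u = 0" by (auto simp: sum_power2_eq_zero_iff)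
  with True show ?thesis using A.prob_space by simp
next
  case False
  then have cp: "c > 0" using c by simp
  interpret A: prob_space "std_gaussian :: 'a measure" by (rule prob_space_std_gaussian)
  interpret AA: pair_prob_space "std_gaussian :: 'a measure" "std_gaussian :: 'a measure" ..
  have K: "K \<ge> 0" using le[of 0] by simp
  have "(\<integral>x. f (c *\<^sub>R x) \<partial>std_gaussian) = (\<integral>x. f (c *\<^sub>R x)
      \<partial>distr (std_gaussian \<Otimes>\<^sub>M std_gaussian) borel (\<lambda>(x, y). (a / c) *\<^sub>R x + (u / c) *\<^sub>R y))"
    using c cp by (subst std_gaussian_combination) (auto simp: power_divide add_divide_distrib[symmetric])
  also have "\<dots> = (\<integral>z. f (a *\<^sub>R fst z + u *\<^sub>R snd z) \<partial>(std_gaussian \<Otimes>\<^sub>M std_gaussian))"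
    using cp by (subst integral_distr) (auto simp: split_beta' scaleR_add_right)
  also have "\<dots> = (\<integral>x. \<integral>y. f (a *\<^sub>R x + u *\<^sub>R y) \<partial>std_gaussian \<partial>std_gaussian)"
  proof (subst AA.integral_fst'[symmetric])
    show "integrable (std_gaussian \<Otimes>\<^sub>M std_gaussian) (\<lambda>z. f (a *\<^sub>R fst z + u *\<^sub>R snd z))"
    proof (rule integrable_std_gaussian_pair_linear_growth)
      fix x y :: 'a
      have "norm (a *\<^sub>R x + u *\<^sub>R y) \<le> a * norm x + u * norm y"
        using c norm_triangle_ineq[of "a *\<^sub>R x" "u *\<^sub>R y"] by simp
      then have "1 + norm (a *\<^sub>R x + u *\<^sub>R y) \<le> (1 + a + u) * (1 + norm x + norm y)"
      proof -
        have "0 \<le> a + u + norm x + norm y + a * norm y + u * norm x" using c by simp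
        with \<open>norm (a *\<^sub>R x + u *\<^sub>R y) \<le> _\<close> show ?thesis by (simp add: algebra_simps)
      qed
      then have "K * (1 + norm (a *\<^sub>R x + u *\<^sub>R y)) \<le> K * ((1 + a + u) * (1 + norm x + norm y))"
        using K by (rule mult_left_mono)
      with le[of "a *\<^sub>R x + u *\<^sub>R y"]
      show "\<bar>f (a *\<^sub>R fst (x, y) + u *\<^sub>R snd (x, y))\<bar> \<le> (K * (1 + a + u)) * (1 + norm x + norm y)"
        by (simp add: mult.assoc)
    qed measurable
  qed simp
  finally show ?thesis .
qed

lemma measurable_log_sum_exp [measurable (raw)]:
  "(\<And>i. i \<in> I \<Longrightarrow> (\<lambda>x. f x i) \<in> borel_measurable M) \<Longrightarrow> (\<lambda>x. log_sum_exp I (f x)) \<in> borel_measurable M"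
  unfolding log_sum_exp_def by measurable

text \<open>Integrates the Taylor expansion with increments \<open>u * (x \<bullet> p i)\<close>.
  The linear term has mean zero and the quadratic one becomes a weighted variance; the factor 1/4 is
  1/2 from Taylor times 1/2 from \<open>weighted_variance\<close>.\<close>

lemma std_gaussian_log_sum_exp_expansion:
  fixes p :: "'i \<Rightarrow> 'a::euclidean_space"
  assumes I: "finite I" "I \<noteq> {}" and u: "u \<ge> 0"
    and w: "\<And>i. w i = exp (y i) / (\<Sum>j\<in>I. exp (y j))"
  shows "\<bar>(\<integral>x. log_sum_exp I (\<lambda>i. y i + u * (x \<bullet> p i)) \<partial>std_gaussian) -
      (log_sum_exp I y + u\<^sup>2 / 4 * (\<Sum>i\<in>I. \<Sum>j\<in>I. w i * w j * (norm (p i - p j))\<^sup>2))\<bar>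
      \<le> u ^ 3 * (\<Sum>i\<in>I. \<integral>x. \<bar>x \<bullet> p i\<bar> ^ 3 \<partial>std_gaussian)"
proof -
  interpret A: prob_space "std_gaussian :: 'a measure" by (rule prob_space_std_gaussian)
  have w1: "(\<Sum>i\<in>I. w i) = 1"
  proof -
    have "(\<Sum>i\<in>I. exp (y i)) > 0" using I by (auto intro!: sum_pos)
    then show ?thesis by (simp add: w sum_divide_distrib[symmetric])
  qed
  let ?h = "\<Sum>i\<in>I. w i *\<^sub>R p i"
  let ?F = "\<lambda>x. log_sum_exp I (\<lambda>i. y i + u * (x \<bullet> p i))"
  let ?T = "\<lambda>x. log_sum_exp I y + u * (x \<bullet> ?h) + u\<^sup>2 / 2 * ((\<Sum>i\<in>I. w i * (x \<bullet> p i)\<^sup>2) - (x \<bullet> ?h)\<^sup>2)"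
  let ?c = "log_sum_exp I y + u * 0 + u\<^sup>2 / 2 * ((\<Sum>i\<in>I. w i * (norm (p i))\<^sup>2) - (norm ?h)\<^sup>2)"
  have T: "has_bochner_integral std_gaussian ?T ?c"
    by (intro has_bochner_integral_add has_bochner_integral_diff has_bochner_integral_sum has_bochner_integral_mult_right
        std_gaussian_moment_1 std_gaussian_moment_2)
      (use A.prob_space in \<open>simp add: has_bochner_integral_iff\<close>)
  have cubes: "integrable std_gaussian (\<lambda>x. u ^ 3 * (\<Sum>i\<in>I. \<bar>x \<bullet> p i\<bar> ^ 3))"
    by (intro integrable_mult_right Bochner_Integration.integrable_sum integrable_std_gaussian_abs_moment)
  have bound: "\<bar>?F x - ?T x\<bar> \<le> u ^ 3 * (\<Sum>i\<in>I. \<bar>x \<bullet> p i\<bar> ^ 3)" for x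
  proof -
    \<comment> \<open>The largest increment. Its cube is one of the terms in the sum of cubes, and
      that sum can be integrated term by term.\<close>
    let ?Z = "Max ((\<lambda>i. u * \<bar>x \<bullet> p i\<bar>) ` I)"
    have "\<bar>?F x - (log_sum_exp I y + (\<Sum>i\<in>I. w i * (u * (x \<bullet> p i))) +
        ((\<Sum>i\<in>I. w i * (u * (x \<bullet> p i))\<^sup>2) - (\<Sum>i\<in>I. w i * (u * (x \<bullet> p i)))\<^sup>2) / 2)\<bar> \<le> ?Z ^ 3"
    proof (rule log_sum_exp_taylor[OF I _ w])
      fix i assume "i \<in> I"
      then have "u * \<bar>x \<bullet> p i\<bar> \<le> ?Z" using I(1) by (intro Max_ge) auto
      then show "\<bar>u * (x \<bullet> p i)\<bar> \<le> ?Z" using u by (simp add: abs_mult)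
    qed
    moreover have "(\<Sum>i\<in>I. w i * (u * (x \<bullet> p i))) = u * (x \<bullet> ?h)"
      by (simp add: inner_sum_right sum_distrib_left mult.left_commute)
    moreover have "(\<Sum>i\<in>I. w i * (u * (x \<bullet> p i))\<^sup>2) = u\<^sup>2 * (\<Sum>i\<in>I. w i * (x \<bullet> p i)\<^sup>2)"
      by (simp add: power_mult_distrib sum_distrib_left mult.left_commute)
    moreover have "?Z ^ 3 \<le> u ^ 3 * (\<Sum>i\<in>I. \<bar>x \<bullet> p i\<bar> ^ 3)"
    proof -
      have "?Z \<in> (\<lambda>i. u * \<bar>x \<bullet> p i\<bar>) ` I" using I by (intro Max_in) auto
      then obtain k where k: "k \<in> I" "?Z = u * \<bar>x \<bullet> p k\<bar>" by blast
      have "\<bar>x \<bullet> p k\<bar> ^ 3 \<le> (\<Sum>i\<in>I. \<bar>x \<bullet> p i\<bar> ^ 3)"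
        using k I by (intro member_le_sum) auto
      then show ?thesis
        unfolding k(2) power_mult_distrib using u by (intro mult_left_mono) auto
    qed
    moreover have "(u * (x \<bullet> ?h))\<^sup>2 = u\<^sup>2 * (x \<bullet> ?h)\<^sup>2" by (rule power_mult_distrib)
    ultimately show ?thesis by (simp add: right_diff_distrib diff_divide_distrib)
  qed
  have D: "integrable std_gaussian (\<lambda>x. ?F x - ?T x)"
  proof (rule Bochner_Integration.integrable_bound[OF cubes])
    show "AE x in std_gaussian. norm (?F x - ?T x) \<le> norm (u ^ 3 * (\<Sum>i\<in>I. \<bar>x \<bullet> p i\<bar> ^ 3))"
      unfolding real_norm_def using order_trans[OF bound abs_ge_self] by (intro always_eventually allI)
  qed measurable
  have "(\<integral>x. ?F x \<partial>std_gaussian) = (\<integral>x. (?F x - ?T x) + ?T x \<partial>std_gaussian)" by simp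
  also have "\<dots> = (\<integral>x. ?F x - ?T x \<partial>std_gaussian) + ?c"
    using D T by (subst Bochner_Integration.integral_add) (auto simp: has_bochner_integral_iff)
  finally have eq: "(\<integral>x. ?F x \<partial>std_gaussian) - ?c = (\<integral>x. ?F x - ?T x \<partial>std_gaussian)" by simp
  have "\<bar>\<integral>x. ?F x - ?T x \<partial>std_gaussian\<bar> \<le> (\<integral>x. \<bar>?F x - ?T x\<bar> \<partial>std_gaussian)"
    by (rule integral_abs_bound)
  also have "\<dots> \<le> (\<integral>x. u ^ 3 * (\<Sum>i\<in>I. \<bar>x \<bullet> p i\<bar> ^ 3) \<partial>std_gaussian)"
    using D cubes bound by (intro integral_mono) auto
  also have "\<dots> = u ^ 3 * (\<Sum>i\<in>I. \<integral>x. \<bar>x \<bullet> p i\<bar> ^ 3 \<partial>std_gaussian)"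
    using integrable_std_gaussian_abs_moment by (subst integral_mult_right_zero, subst Bochner_Integration.integral_sum) auto
  finally have "\<bar>(\<integral>x. ?F x \<partial>std_gaussian) - ?c\<bar> \<le> u ^ 3 * (\<Sum>i\<in>I. \<integral>x. \<bar>x \<bullet> p i\<bar> ^ 3 \<partial>std_gaussian)"
    unfolding eq .
  then show ?thesis
    by (simp add: weighted_variance[OF I(1) w1])
qed

section \<open>Exchanging one Gaussian family for another\<close>

lemma log_sum_exp_growth:
  assumes "finite I" "I \<noteq> {}"
  shows "\<bar>log_sum_exp I v\<bar> \<le> \<bar>log_sum_exp I (\<lambda>_. 0)\<bar> + (\<Sum>i\<in>I. \<bar>v i\<bar>)"
  using log_sum_exp_lipschitz[OF assms, of "\<lambda>_. 0" v] by simp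

lemma log_sum_exp_gaussian_growth:
  fixes p :: "'i \<Rightarrow> 'a::euclidean_space" and q :: "'i \<Rightarrow> 'b::euclidean_space"
  assumes "finite I" "I \<noteq> {}"
  obtains K where "K \<ge> 0" "\<And>v a b x y. \<bar>log_sum_exp I (\<lambda>i. v i + a * (x \<bullet> p i) + b * (y \<bullet> q i))\<bar>
    \<le> K + (\<Sum>i\<in>I. \<bar>v i\<bar>) + \<bar>a\<bar> * K * norm x + \<bar>b\<bar> * K * norm y"
proof -
  define K where "K = \<bar>log_sum_exp I (\<lambda>_. 0)\<bar> + (\<Sum>i\<in>I. norm (p i) + norm (q i))"
  have K: "\<bar>log_sum_exp I (\<lambda>_. 0)\<bar> \<le> K" "(\<Sum>i\<in>I. norm (p i)) \<le> K" "(\<Sum>i\<in>I. norm (q i)) \<le> K" "K \<ge> 0"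
    by (auto simp: K_def sum.distrib intro!: add_nonneg_nonneg sum_nonneg add_increasing add_increasing2)
  show ?thesis
  proof (rule that[OF K(4)])
    fix v a b x y
    have "(\<Sum>i\<in>I. \<bar>v i + a * (x \<bullet> p i) + b * (y \<bullet> q i)\<bar>) \<le>
        (\<Sum>i\<in>I. \<bar>v i\<bar> + \<bar>a\<bar> * (norm x * norm (p i)) + \<bar>b\<bar> * (norm y * norm (q i)))"
    proof (rule sum_mono)
      fix i
      have "\<bar>a * (x \<bullet> p i)\<bar> \<le> \<bar>a\<bar> * (norm x * norm (p i))" "\<bar>b * (y \<bullet> q i)\<bar> \<le> \<bar>b\<bar> * (norm y * norm (q i))"
        unfolding abs_mult by (intro mult_left_mono Cauchy_Schwarz_ineq2; simp)+
      then show "\<bar>v i + a * (x \<bullet> p i) + b * (y \<bullet> q i)\<bar> \<le> \<bar>v i\<bar> + \<bar>a\<bar> * (norm x * norm (p i)) + \<bar>b\<bar> * (norm y * norm (q i))"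
        by linarith
    qed
    also have "\<dots> = (\<Sum>i\<in>I. \<bar>v i\<bar>) + \<bar>a\<bar> * norm x * (\<Sum>i\<in>I. norm (p i)) + \<bar>b\<bar> * norm y * (\<Sum>i\<in>I. norm (q i))"
      by (simp add: sum.distrib sum_distrib_left mult.assoc)
    also have "\<dots> \<le> (\<Sum>i\<in>I. \<bar>v i\<bar>) + \<bar>a\<bar> * norm x * K + \<bar>b\<bar> * norm y * K"
      using K by (intro add_mono mult_left_mono) auto
    finally show "\<bar>log_sum_exp I (\<lambda>i. v i + a * (x \<bullet> p i) + b * (y \<bullet> q i))\<bar>
        \<le> K + (\<Sum>i\<in>I. \<bar>v i\<bar>) + \<bar>a\<bar> * K * norm x + \<bar>b\<bar> * K * norm y"
      using log_sum_exp_growth[OF assms, of "\<lambda>i. v i + a * (x \<bullet> p i) + b * (y \<bullet> q i)"] K(1)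
      by (simp add: mult.assoc mult.commute[of K])
  qed
qed

text \<open>Only the second-order terms of the two expansions differ. They are the variances of the
  increments under the weights \<open>exp (y i)\<close>, so the hypothesis on the distances orders them.\<close>

lemma log_sum_exp_exchange_step:
  fixes p :: "'i \<Rightarrow> 'a::euclidean_space" and q :: "'i \<Rightarrow> 'b::euclidean_space"
  assumes I: "finite I" "I \<noteq> {}" and u: "u \<ge> 0"
    and d: "\<And>i j. i \<in> I \<Longrightarrow> j \<in> I \<Longrightarrow> norm (p i - p j) \<le> norm (q i - q j)"
  shows "(\<integral>x. log_sum_exp I (\<lambda>i. y i + u * (x \<bullet> p i)) \<partial>std_gaussian) \<le>
    (\<integral>x. log_sum_exp I (\<lambda>i. y i + u * (x \<bullet> q i)) \<partial>std_gaussian) +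
    u ^ 3 * ((\<Sum>i\<in>I. \<integral>x. \<bar>x \<bullet> p i\<bar> ^ 3 \<partial>std_gaussian) + (\<Sum>i\<in>I. \<integral>x. \<bar>x \<bullet> q i\<bar> ^ 3 \<partial>std_gaussian))"
proof -
  let ?w = "\<lambda>i. exp (y i) / (\<Sum>j\<in>I. exp (y j))"
  have w: "?w i \<ge> 0" for i by (simp add: sum_nonneg)
  have "(\<Sum>i\<in>I. \<Sum>j\<in>I. ?w i * ?w j * (norm (p i - p j))\<^sup>2) \<le> (\<Sum>i\<in>I. \<Sum>j\<in>I. ?w i * ?w j * (norm (q i - q j))\<^sup>2)"
    using d w by (intro sum_mono mult_left_mono power_mono mult_nonneg_nonneg) auto
  then have "u\<^sup>2 / 4 * (\<Sum>i\<in>I. \<Sum>j\<in>I. ?w i * ?w j * (norm (p i - p j))\<^sup>2) \<le> u\<^sup>2 / 4 * (\<Sum>i\<in>I. \<Sum>j\<in>I. ?w i * ?w j * (norm (q i - q j))\<^sup>2)"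
    by (rule mult_left_mono) simp
  then show ?thesis
    unfolding distrib_left
    using std_gaussian_log_sum_exp_expansion[OF I u, of ?w y p] std_gaussian_log_sum_exp_expansion[OF I u, of ?w y q]
    by linarith
qed

text \<open>Averaging over an extra Gaussian increment enlarges the absolute value by at most the
  constant \<open>?D\<close>, so integrability is inherited. The measure \<open>M\<close> is general
  because the lemma is applied both to a single Gaussian and to a product of two.\<close>

lemma integrable_smoothed_log_sum_exp:
  fixes q :: "'i \<Rightarrow> 'b::euclidean_space"
  assumes I: "finite I" "I \<noteq> {}" and M: "finite_measure M"
    and int: "integrable M (\<lambda>z. log_sum_exp I (V z))"
    and [measurable]: "\<And>i. i \<in> I \<Longrightarrow> (\<lambda>z. V z i) \<in> borel_measurable M"
  shows "integrable M (\<lambda>z. \<integral>y. log_sum_exp I (\<lambda>i. V z i + u * (y \<bullet> q i)) \<partial>std_gaussian)"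
proof -
  interpret M: finite_measure M by (rule M)
  interpret B: prob_space "std_gaussian :: 'b measure" by (rule prob_space_std_gaussian)
  let ?F = "log_sum_exp I"
  let ?S = "\<lambda>y. \<Sum>i\<in>I. \<bar>u * (y \<bullet> q i)\<bar>"
  let ?D = "\<integral>y. ?S y \<partial>std_gaussian"
  have i: "integrable std_gaussian ?S"
    using integrable_std_gaussian_abs_moment[where k=1 and 'a='b]
    by (intro Bochner_Integration.integrable_sum) (simp add: abs_mult)
  have le: "\<bar>?F (\<lambda>i. v i + u * (y \<bullet> q i))\<bar> \<le> \<bar>?F v\<bar> + ?S y" for v y
    using log_sum_exp_lipschitz[OF I, of v "\<lambda>i. u * (y \<bullet> q i)"] by linarith
  have H_le: "\<bar>\<integral>y. ?F (\<lambda>i. v i + u * (y \<bullet> q i)) \<partial>std_gaussian\<bar> \<le> \<bar>?F v\<bar> + ?D" for v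
  proof -
    have iS: "integrable std_gaussian (\<lambda>y. \<bar>?F v\<bar> + ?S y)" using i by simp
    have "integrable std_gaussian (\<lambda>y. ?F (\<lambda>i. v i + u * (y \<bullet> q i)))"
      by (rule Bochner_Integration.integrable_bound[OF iS])
        (measurable, unfold real_norm_def, use order_trans[OF le abs_ge_self] in \<open>intro always_eventually allI\<close>)
    then have "(\<integral>y. \<bar>?F (\<lambda>i. v i + u * (y \<bullet> q i))\<bar> \<partial>std_gaussian) \<le> (\<integral>y. \<bar>?F v\<bar> + ?S y \<partial>std_gaussian)"
      using iS le by (intro integral_mono) auto
    also have "\<dots> = \<bar>?F v\<bar> + ?D"
      using i B.prob_space by (subst Bochner_Integration.integral_add) auto
    finally show ?thesis
      by (rule order_trans[OF integral_abs_bound])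
  qed
  show ?thesis
  proof (rule Bochner_Integration.integrable_bound)
    show "integrable M (\<lambda>z. \<bar>?F (V z)\<bar> + ?D)"
      using int by (intro Bochner_Integration.integrable_add integrable_abs) auto
    show "AE z in M. norm (\<integral>y. ?F (\<lambda>i. V z i + u * (y \<bullet> q i)) \<partial>std_gaussian) \<le> norm (\<bar>?F (V z)\<bar> + ?D)"
      unfolding real_norm_def using order_trans[OF H_le abs_ge_self] by (intro always_eventually allI)
  qed measurable
qed

text \<open>Lindeberg's replacement argument: a Gaussian vector is a sum of independent small copies, which are
  exchanged one at a time, so that no integration by parts is needed. With \<open>u\<^sup>2 = 1 / n\<close> the \<open>n\<close> exchanges
  cost \<open>n * u ^ 3\<close> in total, which tends to 0.\<close>

lemma log_sum_exp_interpolation_step: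
  fixes I :: "'i set" and p :: "'i \<Rightarrow> 'a::euclidean_space" and q :: "'i \<Rightarrow> 'b::euclidean_space"
  defines "\<Psi> \<equiv> \<lambda>a b. \<integral>y. \<integral>x. log_sum_exp I (\<lambda>i. a * (x \<bullet> p i) + b * (y \<bullet> q i)) \<partial>std_gaussian \<partial>std_gaussian"
  assumes I: "finite I" "I \<noteq> {}"
    and d: "\<And>i j. i \<in> I \<Longrightarrow> j \<in> I \<Longrightarrow> norm (p i - p j) \<le> norm (q i - q j)"
    and nn: "u \<ge> 0" "a \<ge> 0" "b \<ge> 0" "c \<ge> 0" "e \<ge> 0" and sq: "c\<^sup>2 = a\<^sup>2 + u\<^sup>2" "e\<^sup>2 = b\<^sup>2 + u\<^sup>2"
  shows "\<Psi> c b \<le> \<Psi> a e +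
    u ^ 3 * ((\<Sum>i\<in>I. \<integral>x. \<bar>x \<bullet> p i\<bar> ^ 3 \<partial>std_gaussian) + (\<Sum>i\<in>I. \<integral>x. \<bar>x \<bullet> q i\<bar> ^ 3 \<partial>std_gaussian))"
    (is "_ \<le> _ + ?E")
proof -
  interpret A: prob_space "std_gaussian :: 'a measure" by (rule prob_space_std_gaussian)
  interpret B: prob_space "std_gaussian :: 'b measure" by (rule prob_space_std_gaussian)
  interpret AB: pair_prob_space "std_gaussian :: 'a measure" "std_gaussian :: 'b measure" ..
  obtain K where K: "K \<ge> 0" "\<And>v a b x y. \<bar>log_sum_exp I (\<lambda>i. v i + a * (x \<bullet> p i) + b * (y \<bullet> q i))\<bar>
    \<le> K + (\<Sum>i\<in>I. \<bar>v i\<bar>) + \<bar>a\<bar> * K * norm x + \<bar>b\<bar> * K * norm y"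
    by (rule log_sum_exp_gaussian_growth[OF I, of p q]) blast
  note Kp = K(2)[of _ _ _ 0, simplified] and Kq = K(2)[of _ 0, simplified] and K0 = K(2)[of "\<lambda>_. 0", simplified]
  let ?F = "log_sum_exp I"
  \<comment> \<open>Log-sum-exp at \<open>v\<close>, averaged over a new increment along
    \<open>q\<close>. It is the common form that the exchange leads to and the merging starts
    from.\<close>
  let ?H = "\<lambda>v. \<integral>y. ?F (\<lambda>i. v i + u * (y \<bullet> q i)) \<partial>(std_gaussian :: 'b measure)"
  have growth: "K + s + \<bar>c\<bar> * K * t \<le> (K + s + \<bar>c\<bar> * K) * (1 + t)" if "s \<ge> 0" "t \<ge> 0" for s c t
  proof -
    have "0 \<le> K * t + s * t + \<bar>c\<bar> * K" using K(1) that by simp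
    then show ?thesis by (simp add: algebra_simps)
  qed
  have intp: "integrable std_gaussian (\<lambda>x. ?F (\<lambda>i. v i + a * (x \<bullet> p i)))" for v a
    by (rule integrable_std_gaussian_linear_growth[where K="K + (\<Sum>i\<in>I. \<bar>v i\<bar>) + \<bar>a\<bar> * K"])
      (measurable, rule order_trans[OF Kp growth], simp_all add: sum_nonneg)
  have intF: "integrable (std_gaussian \<Otimes>\<^sub>M std_gaussian) (\<lambda>(x, y). ?F (\<lambda>i. a * (x \<bullet> p i) + b * (y \<bullet> q i)))" for a b
  proof (rule integrable_std_gaussian_pair_linear_growth)
    fix x y
    have "\<bar>?F (\<lambda>i. a * (x \<bullet> p i) + b * (y \<bullet> q i))\<bar> \<le> K + \<bar>a\<bar> * K * norm x + \<bar>b\<bar> * K * norm y"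
      by (rule K0)
    also have "\<dots> \<le> (K + \<bar>a\<bar> * K + \<bar>b\<bar> * K) * (1 + norm x + norm y)"
      using K(1) by (simp add: algebra_simps add_increasing add_increasing2)
    finally show "\<bar>case (x, y) of (x, y) \<Rightarrow> ?F (\<lambda>i. a * (x \<bullet> p i) + b * (y \<bullet> q i))\<bar> \<le> (K + \<bar>a\<bar> * K + \<bar>b\<bar> * K) * (1 + norm x + norm y)"
      by simp
  qed measurable
  have intH: "integrable (std_gaussian \<Otimes>\<^sub>M std_gaussian) (\<lambda>(x, y). ?H (\<lambda>i. a * (x \<bullet> p i) + b * (y \<bullet> q i)))"
  proof -
    have "integrable (std_gaussian \<Otimes>\<^sub>M std_gaussian) (\<lambda>z. ?H (\<lambda>i. a * (fst z \<bullet> p i) + b * (snd z \<bullet> q i)))"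
      using intF[of a b] by (intro integrable_smoothed_log_sum_exp I AB.finite_measure_axioms) (auto simp: split_beta')
    then show ?thesis by (simp add: split_beta')
  qed
  \<comment> \<open>For fixed \<open>y\<close>, the factor \<open>c\<close> is split into
    \<open>a\<close> and an independent increment of size \<open>u\<close>, which is exchanged for
    one along \<open>q\<close> with \<open>a * (x \<bullet> p i) + b * (y \<bullet> q i)\<close> as
    base point. The error \<open>?E\<close> does not depend on that point, so it passes through both
    integrals unchanged.\<close>
  have "\<Psi> c b \<le> (\<integral>y. (\<integral>x. ?H (\<lambda>i. a * (x \<bullet> p i) + b * (y \<bullet> q i)) \<partial>std_gaussian) + ?E \<partial>std_gaussian)"
    unfolding \<Psi>_def
  proof (rule integral_mono)
    show "integrable std_gaussian (\<lambda>y. \<integral>x. ?F (\<lambda>i. c * (x \<bullet> p i) + b * (y \<bullet> q i)) \<partial>std_gaussian)"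
      using AB.integrable_snd[OF intF] by simp
    show "integrable std_gaussian (\<lambda>y. (\<integral>x. ?H (\<lambda>i. a * (x \<bullet> p i) + b * (y \<bullet> q i)) \<partial>std_gaussian) + ?E)"
      using AB.integrable_snd[OF intH] by simp
    fix y :: 'b
    let ?v = "\<lambda>i. b * (y \<bullet> q i)"
    have intv: "integrable std_gaussian (\<lambda>x. ?F (\<lambda>i. a * (x \<bullet> p i) + ?v i))"
      using intp[of ?v a] by (simp add: add.commute)
    have i1: "integrable std_gaussian (\<lambda>x. ?H (\<lambda>i. a * (x \<bullet> p i) + ?v i))"
      using intv by (intro integrable_smoothed_log_sum_exp I A.finite_measure_axioms) auto
    have "(\<integral>x. ?F (\<lambda>i. c * (x \<bullet> p i) + ?v i) \<partial>std_gaussian) = (\<integral>x. ?F (\<lambda>i. (c *\<^sub>R x) \<bullet> p i + ?v i) \<partial>std_gaussian)"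
      by simp
    also have "\<dots> = (\<integral>x. \<integral>x'. ?F (\<lambda>i. (a *\<^sub>R x + u *\<^sub>R x') \<bullet> p i + ?v i) \<partial>std_gaussian \<partial>std_gaussian)"
    proof (rule std_gaussian_integral_split[where K="K + (\<Sum>i\<in>I. \<bar>?v i\<bar>) + \<bar>1\<bar> * K"])
      fix x
      show "\<bar>?F (\<lambda>i. x \<bullet> p i + ?v i)\<bar> \<le> (K + (\<Sum>i\<in>I. \<bar>?v i\<bar>) + \<bar>1\<bar> * K) * (1 + norm x)"
        using order_trans[OF Kp[of ?v 1 x] growth[of "\<Sum>i\<in>I. \<bar>?v i\<bar>" "norm x" 1]]
        by (simp add: add.commute sum_nonneg)
    qed (use nn sq in measurable)
    also have "\<dots> = (\<integral>x. \<integral>x'. ?F (\<lambda>i. (a * (x \<bullet> p i) + ?v i) + u * (x' \<bullet> p i)) \<partial>std_gaussian \<partial>std_gaussian)"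
      by (simp add: inner_add_left algebra_simps)
    also have "\<dots> \<le> (\<integral>x. ?H (\<lambda>i. a * (x \<bullet> p i) + ?v i) + ?E \<partial>std_gaussian)"
    proof (rule integral_mono)
      show "integrable std_gaussian (\<lambda>x. \<integral>x'. ?F (\<lambda>i. (a * (x \<bullet> p i) + ?v i) + u * (x' \<bullet> p i)) \<partial>std_gaussian)"
        using intv by (intro integrable_smoothed_log_sum_exp I A.finite_measure_axioms) auto
      show "integrable std_gaussian (\<lambda>x. ?H (\<lambda>i. a * (x \<bullet> p i) + ?v i) + ?E)"
        using i1 by simp
      fix x
      show "(\<integral>x'. ?F (\<lambda>i. (a * (x \<bullet> p i) + ?v i) + u * (x' \<bullet> p i)) \<partial>std_gaussian) \<le> ?H (\<lambda>i. a * (x \<bullet> p i) + ?v i) + ?E"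
        by (rule log_sum_exp_exchange_step[OF I nn(1) d])
    qed
    also have "\<dots> = (\<integral>x. ?H (\<lambda>i. a * (x \<bullet> p i) + ?v i) \<partial>std_gaussian) + ?E"
      using i1 A.prob_space by (subst Bochner_Integration.integral_add) auto
    finally show "(\<integral>x. ?F (\<lambda>i. c * (x \<bullet> p i) + ?v i) \<partial>std_gaussian) \<le> (\<integral>x. ?H (\<lambda>i. a * (x \<bullet> p i) + ?v i) \<partial>std_gaussian) + ?E" .
  qed
  also have "\<dots> = (\<integral>y. (\<integral>x. ?H (\<lambda>i. a * (x \<bullet> p i) + b * (y \<bullet> q i)) \<partial>std_gaussian) \<partial>std_gaussian) + ?E"
    using AB.integrable_snd[OF intH] B.prob_space by (subst Bochner_Integration.integral_add) auto
  \<comment> \<open>The order of integration is reversed so that, for fixed \<open>x\<close>, the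
    variable \<open>y\<close> of size \<open>b\<close> and the increment of size \<open>u\<close>
    can be merged into one Gaussian of size \<open>e\<close>.\<close>
  also have "(\<integral>y. (\<integral>x. ?H (\<lambda>i. a * (x \<bullet> p i) + b * (y \<bullet> q i)) \<partial>std_gaussian) \<partial>std_gaussian) =
      (\<integral>x. (\<integral>y. ?H (\<lambda>i. a * (x \<bullet> p i) + b * (y \<bullet> q i)) \<partial>std_gaussian) \<partial>std_gaussian)"
    by (rule AB.Fubini_integral[OF intH])
  also have "\<dots> = (\<integral>x. (\<integral>y. ?F (\<lambda>i. a * (x \<bullet> p i) + e * (y \<bullet> q i)) \<partial>std_gaussian) \<partial>std_gaussian)"
  proof (rule Bochner_Integration.integral_cong[OF refl])
    fix x :: 'a
    let ?v = "\<lambda>i. a * (x \<bullet> p i)"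
    have "(\<integral>y. ?F (\<lambda>i. ?v i + e * (y \<bullet> q i)) \<partial>std_gaussian) = (\<integral>y. ?F (\<lambda>i. ?v i + (e *\<^sub>R y) \<bullet> q i) \<partial>std_gaussian)"
      by simp
    also have "\<dots> = (\<integral>y. \<integral>y'. ?F (\<lambda>i. ?v i + (b *\<^sub>R y + u *\<^sub>R y') \<bullet> q i) \<partial>std_gaussian \<partial>std_gaussian)"
    proof (rule std_gaussian_integral_split[where K="K + (\<Sum>i\<in>I. \<bar>?v i\<bar>) + \<bar>1\<bar> * K"])
      fix y
      show "\<bar>?F (\<lambda>i. ?v i + y \<bullet> q i)\<bar> \<le> (K + (\<Sum>i\<in>I. \<bar>?v i\<bar>) + \<bar>1\<bar> * K) * (1 + norm y)"
        using order_trans[OF Kq[of ?v 1 y] growth[of "\<Sum>i\<in>I. \<bar>?v i\<bar>" "norm y" 1]]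
        by (simp add: add.commute sum_nonneg)
    qed (use nn sq in measurable)
    also have "\<dots> = (\<integral>y. ?H (\<lambda>i. ?v i + b * (y \<bullet> q i)) \<partial>std_gaussian)"
      by (simp add: inner_add_left algebra_simps)
    finally show "(\<integral>y. ?H (\<lambda>i. ?v i + b * (y \<bullet> q i)) \<partial>std_gaussian) = (\<integral>y. ?F (\<lambda>i. ?v i + e * (y \<bullet> q i)) \<partial>std_gaussian)" ..
  qed
  also have "\<dots> = \<Psi> a e"
    unfolding \<Psi>_def by (rule AB.Fubini_integral[OF intF, symmetric])
  finally show ?thesis .
qed

lemma log_sum_exp_gaussian_comparison:
  fixes I :: "'i set" and p :: "'i \<Rightarrow> 'a::euclidean_space" and q :: "'i \<Rightarrow> 'b::euclidean_space"
  assumes I: "finite I" "I \<noteq> {}"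
    and d: "\<And>i j. i \<in> I \<Longrightarrow> j \<in> I \<Longrightarrow> norm (p i - p j) \<le> norm (q i - q j)"
  shows "(\<integral>x. log_sum_exp I (\<lambda>i. x \<bullet> p i) \<partial>std_gaussian) \<le> (\<integral>y. log_sum_exp I (\<lambda>i. y \<bullet> q i) \<partial>std_gaussian)"
proof -
  interpret A: prob_space "std_gaussian :: 'a measure" by (rule prob_space_std_gaussian)
  interpret B: prob_space "std_gaussian :: 'b measure" by (rule prob_space_std_gaussian)
  define \<Psi> where "\<Psi> a b = (\<integral>y. \<integral>x. log_sum_exp I (\<lambda>i. a * (x \<bullet> p i) + b * (y \<bullet> q i)) \<partial>std_gaussian \<partial>std_gaussian)" for a b
  define C where "C = (\<Sum>i\<in>I. \<integral>x. \<bar>x \<bullet> p i\<bar> ^ 3 \<partial>std_gaussian) + (\<Sum>i\<in>I. \<integral>x. \<bar>x \<bullet> q i\<bar> ^ 3 \<partial>std_gaussian)"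
  have le: "\<Psi> 1 0 \<le> \<Psi> 0 1 + C * sqrt (1 / real n)" if n: "n > 0" for n :: nat
  proof -
    \<comment> \<open>At stage \<open>k\<close> a share \<open>k / n\<close> of the variance is
      carried by \<open>p\<close> and the rest by \<open>q\<close>. Passing from \<open>k\<close> to
      \<open>Suc k\<close> moves a share \<open>1 / n\<close>, so the exchanged increment has size
      \<open>sqrt (1 / n)\<close>.\<close>
    have "\<Psi> (sqrt (k / n)) (sqrt ((n - k) / n)) \<le> \<Psi> 0 1 + k * (sqrt (1 / n) ^ 3 * C)" if "k \<le> n" for k :: nat
      using that
    proof (induction k)
      case 0
      show ?case using n by simp
    next
      case (Suc k)
      have "\<Psi> (sqrt (Suc k / n)) (sqrt ((n - Suc k) / n)) \<le> \<Psi> (sqrt (k / n)) (sqrt ((n - k) / n)) + sqrt (1 / n) ^ 3 * C"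
        unfolding \<Psi>_def C_def
        by (rule log_sum_exp_interpolation_step[OF I d]) (use Suc.prems n in \<open>auto simp: field_simps of_nat_diff\<close>)
      with Suc show ?case by (simp add: algebra_simps)
    qed
    from this[of n] have "\<Psi> 1 0 \<le> \<Psi> 0 1 + n * (sqrt (1 / n) ^ 3 * C)" using n by simp
    also have "n * (sqrt (1 / n) ^ 3 * C) = C * sqrt (1 / n)"
      using n by (simp add: power3_eq_cube real_sqrt_divide field_simps)
    finally show ?thesis .
  qed
  have "(\<lambda>n. \<Psi> 0 1 + C * sqrt (1 / real n)) \<longlonglongrightarrow> \<Psi> 0 1 + C * sqrt 0"
    by (intro tendsto_intros lim_1_over_n)
  then have "\<Psi> 1 0 \<le> \<Psi> 0 1"
    using le by (intro LIMSEQ_le_const[of "\<lambda>n. \<Psi> 0 1 + C * sqrt (1 / real n)"]) (auto intro!: exI[of _ 1])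
  then show ?thesis
    using A.prob_space B.prob_space by (simp add: \<Psi>_def)
qed

section \<open>From log-sum-exp to the maximum\<close>

lemma integrable_sum_abs_inner_std_gaussian:
  "integrable std_gaussian (\<lambda>x :: 'a::euclidean_space. \<Sum>i\<in>I. \<bar>x \<bullet> v i\<bar>)"
  using integrable_std_gaussian_abs_moment[where k=1 and 'a='a]
  by (intro Bochner_Integration.integrable_sum) simp

lemma integrable_log_sum_exp_std_gaussian:
  fixes v :: "'i \<Rightarrow> 'a::euclidean_space"
  assumes I: "finite I" "I \<noteq> {}"
  shows "integrable std_gaussian (\<lambda>x. log_sum_exp I (\<lambda>i. x \<bullet> v i))"
proof (rule Bochner_Integration.integrable_bound)
  interpret A: prob_space "std_gaussian :: 'a measure" by (rule prob_space_std_gaussian)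
  show "integrable std_gaussian (\<lambda>x. \<bar>log_sum_exp I (\<lambda>_. 0)\<bar> + (\<Sum>i\<in>I. \<bar>x \<bullet> v i\<bar>))"
    by (intro Bochner_Integration.integrable_add A.integrable_const integrable_sum_abs_inner_std_gaussian)
  show "AE x in std_gaussian. norm (log_sum_exp I (\<lambda>i. x \<bullet> v i)) \<le>
      norm (\<bar>log_sum_exp I (\<lambda>_. 0)\<bar> + (\<Sum>i\<in>I. \<bar>x \<bullet> v i\<bar>))"
    unfolding real_norm_def using order_trans[OF log_sum_exp_growth[OF I] abs_ge_self]
    by (intro always_eventually allI)
qed measurable

lemma abs_Max_le_sum_abs:
  fixes f :: "'i \<Rightarrow> real"
  assumes I: "finite I" "I \<noteq> {}"
  shows "\<bar>Max (f ` I)\<bar> \<le> (\<Sum>i\<in>I. \<bar>f i\<bar>)"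
proof -
  have "Max (f ` I) \<in> f ` I" using I by (intro Max_in) auto
  then obtain i where i: "i \<in> I" "Max (f ` I) = f i" by blast
  show ?thesis unfolding i(2) using i(1) I(1) by (intro member_le_sum) auto
qed

lemma integrable_Max_std_gaussian:
  fixes v :: "'i \<Rightarrow> 'a::euclidean_space"
  assumes I: "finite I" "I \<noteq> {}"
  shows "integrable std_gaussian (\<lambda>x. Max ((\<lambda>i. x \<bullet> v i) ` I))"
proof (rule Bochner_Integration.integrable_bound[OF integrable_sum_abs_inner_std_gaussian])
  show "AE x in std_gaussian. norm (Max ((\<lambda>i. x \<bullet> v i) ` I)) \<le> norm (\<Sum>i\<in>I. \<bar>x \<bullet> v i\<bar>)"
    unfolding real_norm_def using order_trans[OF abs_Max_le_sum_abs[OF I] abs_ge_self]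
    by (intro always_eventually allI)
qed (use I(1) in measurable)

lemma Max_inner_scaleR:
  fixes v :: "'i \<Rightarrow> 'a::real_inner"
  assumes I: "finite I" "I \<noteq> {}" and t: "t > 0"
  shows "Max ((\<lambda>i. x \<bullet> (t *\<^sub>R v i)) ` I) = t * Max ((\<lambda>i. x \<bullet> v i) ` I)"
  using mono_Max_commute[of "\<lambda>s. t * s" "(\<lambda>i. x \<bullet> v i) ` I"] I t
  by (simp add: mono_def image_image)

text \<open>Scaling all points by \<open>n\<close> preserves the hypothesis and multiplies both
  maxima by \<open>n\<close>, while log-sum-exp exceeds the maximum by at most
  \<open>ln (card I)\<close> at every scale. Divided by \<open>n\<close>, this error vanishes in the
  limit.\<close>

lemma sudakov_fernique:
  fixes I :: "'i set" and p :: "'i \<Rightarrow> 'a::euclidean_space" and q :: "'i \<Rightarrow> 'b::euclidean_space"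
  assumes I: "finite I" "I \<noteq> {}"
    and d: "\<And>i j. i \<in> I \<Longrightarrow> j \<in> I \<Longrightarrow> norm (p i - p j) \<le> norm (q i - q j)"
  shows "(\<integral>x. Max ((\<lambda>i. x \<bullet> p i) ` I) \<partial>std_gaussian) \<le> (\<integral>y. Max ((\<lambda>i. y \<bullet> q i) ` I) \<partial>std_gaussian)"
proof -
  interpret B: prob_space "std_gaussian :: 'b measure" by (rule prob_space_std_gaussian)
  let ?P = "\<integral>x. Max ((\<lambda>i. x \<bullet> p i) ` I) \<partial>std_gaussian" and ?Q = "\<integral>y. Max ((\<lambda>i. y \<bullet> q i) ` I) \<partial>std_gaussian"
  note int = integrable_Max_std_gaussian[OF I] integrable_log_sum_exp_std_gaussian[OF I]
  note scale = Max_inner_scaleR[OF I]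
  have le: "?P \<le> ?Q + ln (card I) * (1 / real n)" if n: "n > 0" for n :: nat
  proof -
    have "n * ?P = (\<integral>x. Max ((\<lambda>i. x \<bullet> (n *\<^sub>R p i)) ` I) \<partial>std_gaussian)"
      using n by (subst scale) auto
    also have "\<dots> \<le> (\<integral>x. log_sum_exp I (\<lambda>i. x \<bullet> (n *\<^sub>R p i)) \<partial>std_gaussian)"
      by (intro integral_mono int Max_le_log_sum_exp I)
    also have "\<dots> \<le> (\<integral>y. log_sum_exp I (\<lambda>i. y \<bullet> (n *\<^sub>R q i)) \<partial>std_gaussian)"
      using d by (intro log_sum_exp_gaussian_comparison I) (auto simp: scaleR_diff_right[symmetric] mult_left_mono)
    also have "\<dots> \<le> (\<integral>y. Max ((\<lambda>i. y \<bullet> (n *\<^sub>R q i)) ` I) + ln (card I) \<partial>std_gaussian)"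
      by (intro integral_mono Max_le_log_sum_exp I Bochner_Integration.integrable_add int B.integrable_const)
    also have "\<dots> = (\<integral>y. Max ((\<lambda>i. y \<bullet> (n *\<^sub>R q i)) ` I) \<partial>std_gaussian) + ln (card I)"
      using int[of "\<lambda>i. n *\<^sub>R q i"] B.prob_space by (subst Bochner_Integration.integral_add) auto
    also have "\<dots> = n * ?Q + ln (card I)"
      using n by (subst scale) auto
    finally show ?thesis using n by (simp add: field_simps)
  qed
  have "(\<lambda>n. ?Q + ln (card I) * (1 / real n)) \<longlonglongrightarrow> ?Q + ln (card I) * 0"
    by (intro tendsto_intros lim_1_over_n)
  then show ?thesis
    using le by (intro LIMSEQ_le_const[of "\<lambda>n. ?Q + ln (card I) * (1 / real n)"]) (auto intro!: exI[of _ 1])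
qed

section \<open>The expected operator norm of a Gaussian matrix\<close>

text \<open>Carries a bound from finite maxima to a supremum over an infinite set. By continuity a
  countable dense subset determines the supremum, which is therefore an increasing limit of finite
  maxima; this gives measurability, and the envelope \<open>B\<close> gives dominated
  convergence.\<close>

lemma integral_Sup_le:
  fixes f :: "'w \<Rightarrow> 'e::{metric_space, second_countable_topology} \<Rightarrow> real"
  assumes S: "S \<noteq> {}"
    and cont: "\<And>w. w \<in> space M \<Longrightarrow> continuous_on S (f w)"
    and meas: "\<And>x. x \<in> S \<Longrightarrow> (\<lambda>w. f w x) \<in> borel_measurable M"
    and B: "integrable M B" "\<And>w x. w \<in> space M \<Longrightarrow> x \<in> S \<Longrightarrow> \<bar>f w x\<bar> \<le> B w"
    and Max: "\<And>F. finite F \<Longrightarrow> F \<noteq> {} \<Longrightarrow> F \<subseteq> S \<Longrightarrow> (\<integral>w. Max (f w ` F) \<partial>M) \<le> c"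
  shows "integrable M (\<lambda>w. SUP x\<in>S. f w x)" "(\<integral>w. (SUP x\<in>S. f w x) \<partial>M) \<le> c"
proof -
  obtain T where T: "countable T" "T \<subseteq> S" "S \<subseteq> closure T"
    using separable by blast
  with S have "T \<noteq> {}" by auto
  define t where "t = from_nat_into T"
  have rt: "range t = T" using T(1) \<open>T \<noteq> {}\<close> by (simp add: t_def range_from_nat_into)
  then have tS: "t n \<in> S" for n using T(2) by auto
  define g where "g n w = Max (f w ` t ` {..n})" for n w
  have g_meas: "g n \<in> borel_measurable M" for n
    unfolding g_def image_image using meas[OF tS] by (intro borel_measurable_Max) auto
  have bdd: "bdd_above (f w ` S)" if "w \<in> space M" for w
    using B(2)[OF that] by (intro bdd_aboveI2[where M="B w"]) (auto dest: abs_le_D1)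
  have lim: "(\<lambda>n. g n w) \<longlonglongrightarrow> (SUP x\<in>S. f w x)" if w: "w \<in> space M" for w
  proof (rule increasing_LIMSEQ)
    show "g n w \<le> g (Suc n) w" for n
      unfolding g_def by (intro Max_mono) auto
    show "g n w \<le> (SUP x\<in>S. f w x)" for n
      unfolding g_def using tS bdd[OF w] by (subst Max_le_iff) (auto intro: cSUP_upper)
    fix e :: real assume e: "e > 0"
    then have "(SUP x\<in>S. f w x) - e / 2 < (SUP x\<in>S. f w x)" by simp
    then obtain x where x: "x \<in> S" "(SUP x\<in>S. f w x) - e / 2 < f w x"
      using less_cSUP_iff[OF S bdd[OF w]] by blast
    obtain d where d: "d > 0" "\<And>y. y \<in> S \<Longrightarrow> dist y x < d \<Longrightarrow> dist (f w y) (f w x) < e / 2"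
      using cont[OF w] x(1) e unfolding continuous_on_iff by (meson half_gt_zero)
    have "x \<in> closure T" using x(1) T(3) by blast
    then obtain y where y: "y \<in> T" "dist y x < d"
      using d(1) closure_approachable by blast
    then obtain n where n: "y = t n" using rt by blast
    have "f w y \<le> g n w"
      unfolding g_def n by (intro Max_ge) auto
    moreover have "\<bar>f w y - f w x\<bar> < e / 2"
      using d(2)[of y] y T(2) by (auto simp: dist_real_def)
    ultimately have "(SUP x\<in>S. f w x) \<le> g n w + e"
      using x(2) by linarith
    then show "\<exists>n. (SUP x\<in>S. f w x) \<le> g n w + e" ..
  qed
  have gB: "norm (g n w) \<le> B w" if "w \<in> space M" for n w
  proof -
    have "Max (f w ` t ` {..n}) \<in> f w ` t ` {..n}" by (intro Max_in) auto
    then obtain k where "g n w = f w (t k)" unfolding g_def by (elim imageE) blast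
    then show ?thesis using B(2)[OF that tS, of k] by simp
  qed
  have sup_meas: "(\<lambda>w. SUP x\<in>S. f w x) \<in> borel_measurable M"
    by (rule borel_measurable_LIMSEQ_real[OF lim g_meas])
  show "integrable M (\<lambda>w. SUP x\<in>S. f w x)"
    using lim gB by (intro integrable_dominated_convergence[where s=g, OF sup_meas g_meas B(1)]) auto
  have "(\<lambda>n. \<integral>w. g n w \<partial>M) \<longlonglongrightarrow> (\<integral>w. (SUP x\<in>S. f w x) \<partial>M)"
    using lim gB by (intro integral_dominated_convergence[where s=g, OF sup_meas g_meas B(1)]) auto
  moreover have "(\<integral>w. g n w \<partial>M) \<le> c" for n
    unfolding g_def using tS by (intro Max) auto
  ultimately show "(\<integral>w. (SUP x\<in>S. f w x) \<partial>M) \<le> c"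
    by (intro LIMSEQ_le_const2) auto
qed

section \<open>Bilinear forms as a Gaussian process on pairs of unit vectors\<close>

definition outer_product :: "real^'m \<Rightarrow> real^'n \<Rightarrow> real^'n^'m" where
  "outer_product v u = (\<chi> i j. v $ i * u $ j)"

lemma inner_outer_product: "G \<bullet> outer_product v u = v \<bullet> (G *v u)"
  by (simp add: inner_vec_def outer_product_def matrix_vector_mult_def sum_distrib_left mult_ac)

lemma outer_product_inner: "outer_product v u \<bullet> outer_product v' u' = (v \<bullet> v') * (u \<bullet> u')"
  by (simp add: inner_vec_def outer_product_def sum_product mult_ac, subst sum.swap, rule refl)

text \<open>The squares of the two sides differ by exactly
  \<open>2 * (1 - v \<bullet> v') * (1 - u \<bullet> u')\<close>, which is nonnegative for unit
  vectors. This is the hypothesis of \<open>sudakov_fernique\<close>, with the pair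
  \<open>(u, v)\<close> itself as the point of the dominating process.\<close>

lemma norm_outer_product_diff_le:
  assumes "norm u = 1" "norm v = 1" "norm u' = 1" "norm v' = 1"
  shows "norm (outer_product v u - outer_product v' u') \<le> norm ((u, v) - (u', v'))"
proof -
  have le: "0 \<le> (1 - v \<bullet> v') * (1 - u \<bullet> u')"
    using norm_cauchy_schwarz[of u u'] norm_cauchy_schwarz[of v v'] assms by simp
  have one: "u \<bullet> u = 1" "v \<bullet> v = 1" "u' \<bullet> u' = 1" "v' \<bullet> v' = 1"
    using assms by (simp_all add: dot_square_norm)
  have "(norm (outer_product v u - outer_product v' u'))\<^sup>2 = 2 - 2 * ((v \<bullet> v') * (u \<bullet> u'))"
    by (simp add: power2_norm_eq_inner inner_diff outer_product_inner one inner_commute)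
  also have "\<dots> \<le> (2 - 2 * (u \<bullet> u')) + (2 - 2 * (v \<bullet> v'))"
    using le by (simp add: algebra_simps)
  also have "\<dots> = (norm ((u, v) - (u', v')))\<^sup>2"
    by (simp add: power2_norm_eq_inner inner_diff one inner_commute)
  finally show ?thesis by (rule power2_le_imp_le) simp
qed

text \<open>This is the operator norm of \<open>G\<close>, written as the supremum of a Gaussian
  process over a product of spheres, the form to which \<open>integral_Sup_le\<close>
  applies.\<close>

definition sup_bilinear :: "real^'n^'m \<Rightarrow> real" where
  "sup_bilinear G = (SUP (u, v) \<in> sphere 0 1 \<times> sphere 0 1. v \<bullet> (G *v u))"

lemma bilinear_le_norm: "u \<in> sphere 0 1 \<Longrightarrow> v \<in> sphere 0 1 \<Longrightarrow> \<bar>v \<bullet> (G *v u)\<bar> \<le> norm G"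
  for G :: "real^'n^'m"
proof -
  assume uv: "u \<in> sphere 0 1" "v \<in> sphere 0 1"
  have "\<bar>v \<bullet> (G *v u)\<bar> \<le> norm G * norm (outer_product v u)"
    unfolding inner_outer_product[symmetric] by (rule Cauchy_Schwarz_ineq2)
  also have "norm (outer_product v u) = 1"
    using uv by (simp add: norm_eq_1 outer_product_inner)
  finally show ?thesis by simp
qed

lemma onorm_le_sup_bilinear: "onorm ((*v) G) \<le> sup_bilinear G" for G :: "real^'n^'m"
proof (rule onorm_le)
  have bdd: "bdd_above ((\<lambda>(u, v). v \<bullet> (G *v u)) ` (sphere 0 1 \<times> sphere 0 1))"
    by (intro bdd_aboveI2[where M="norm G"]) (use abs_le_D1[OF bilinear_le_norm[of _ _ G]] in auto)
  have up: "v \<bullet> (G *v u) \<le> sup_bilinear G" if "norm u = 1" "norm v = 1" for u v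
    unfolding sup_bilinear_def using that cSUP_upper[OF _ bdd, of "(u, v)"] by auto
  \<comment> \<open>Flipping the sign of \<open>v\<close> flips the sign of the form, so one of the
    two values is nonnegative.\<close>
  have nn: "sup_bilinear G \<ge> 0"
  proof -
    obtain u :: "real^'n" and v :: "real^'m" where uv: "norm u = 1" "norm v = 1"
      using vector_choose_size[of 1] by (metis zero_le_one)
    then show ?thesis using up[of u v] up[of u "- v"] by simp
  qed
  fix x :: "real^'n"
  show "norm (G *v x) \<le> sup_bilinear G * norm x"
  proof (cases "G *v x = 0")
    case True
    then show ?thesis using nn by simp
  next
    case False
    then have x: "x \<noteq> 0" by auto
    have "(G *v x /\<^sub>R norm (G *v x)) \<bullet> (G *v (x /\<^sub>R norm x)) \<le> sup_bilinear G"
      using False x by (intro up) auto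
    then have "norm (G *v x) / norm x \<le> sup_bilinear G"
      using False by (simp add: matrix_vector_mult_scaleR dot_square_norm power2_eq_square field_simps)
    then show ?thesis using x by (simp add: divide_le_eq)
  qed
qed

text \<open>A pair of unit vectors has norm \<open>sqrt 2\<close>, so Cauchy-Schwarz bounds the
  dominating maximum by \<open>sqrt 2 * norm z\<close>; the mean norm of a Gaussian pair is at most
  the square root of the total dimension.\<close>

lemma expectation_sup_bilinear:
  "integrable std_gaussian (sup_bilinear :: real^'n^'m \<Rightarrow> real)"
  "(\<integral>G. sup_bilinear G \<partial>(std_gaussian :: (real^'n^'m) measure)) \<le> sqrt 2 * sqrt (real CARD('n) + real CARD('m))"
proof -
  let ?S = "sphere (0 :: real^'n) 1 \<times> sphere (0 :: real^'m) 1"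
  let ?f = "\<lambda>G :: real^'n^'m. \<lambda>(u, v). v \<bullet> (G *v u)"
  let ?\<gamma> = "std_gaussian :: ((real^'n) \<times> (real^'m)) measure"
  have ne: "?S \<noteq> {}" by (auto simp: sphere_eq_empty)
  have cont: "continuous_on ?S (?f G)" for G
    unfolding split_beta' by (intro continuous_intros linear_continuous_on matrix_vector_mul_bounded_linear
        continuous_on_compose2[OF linear_continuous_on[OF matrix_vector_mul_bounded_linear]]) auto
  have meas: "(\<lambda>G. ?f G x) \<in> borel_measurable std_gaussian" if "x \<in> ?S" for x
    by (cases x) (simp add: inner_outer_product[symmetric])
  have B: "integrable std_gaussian (norm :: real^'n^'m \<Rightarrow> real)"
    by (rule std_gaussian_norm)
  have le: "\<bar>?f G x\<bar> \<le> norm G" if "x \<in> ?S" for G x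
    using that bilinear_le_norm by auto
  have mx: "(\<integral>G. Max (?f G ` F) \<partial>std_gaussian) \<le> sqrt 2 * sqrt (real CARD('n) + real CARD('m))"
    if F: "finite F" "F \<noteq> {}" "F \<subseteq> ?S" for F
  proof -
    have "(\<integral>G. Max (?f G ` F) \<partial>std_gaussian) = (\<integral>G. Max ((\<lambda>z. G \<bullet> outer_product (snd z) (fst z)) ` F) \<partial>std_gaussian)"
      by (simp add: inner_outer_product split_beta')
    also have "\<dots> \<le> (\<integral>z. Max ((\<lambda>w. z \<bullet> w) ` F) \<partial>?\<gamma>)"
    proof (rule sudakov_fernique[OF F(1,2)])
      fix z w assume "z \<in> F" "w \<in> F"
      then have "z \<in> ?S" "w \<in> ?S" using F(3) by blast+
      then have "norm (fst z) = 1" "norm (snd z) = 1" "norm (fst w) = 1" "norm (snd w) = 1" by auto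
      from norm_outer_product_diff_le[OF this] show "norm (outer_product (snd z) (fst z) - outer_product (snd w) (fst w)) \<le> norm (z - w)"
        by simp
    qed
    also have "\<dots> \<le> (\<integral>z. sqrt 2 * norm z \<partial>?\<gamma>)"
    proof (rule integral_mono)
      show "integrable ?\<gamma> (\<lambda>z. Max ((\<lambda>w. z \<bullet> w) ` F))"
        by (rule integrable_Max_std_gaussian[OF F(1,2)])
      show "integrable ?\<gamma> (\<lambda>z. sqrt 2 * norm z)"
        using std_gaussian_norm(1) by simp
      fix z :: "(real^'n) \<times> (real^'m)"
      show "Max ((\<lambda>w. z \<bullet> w) ` F) \<le> sqrt 2 * norm z"
      proof (subst Max_le_iff)
        show "\<forall>a\<in>(\<lambda>w. z \<bullet> w) ` F. a \<le> sqrt 2 * norm z"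
        proof
          fix a assume "a \<in> (\<lambda>w. z \<bullet> w) ` F"
          then obtain w where w: "w \<in> F" "a = z \<bullet> w" by blast
          then have "norm w = sqrt 2" using F(3) by (auto simp: norm_Pair)
          then show "a \<le> sqrt 2 * norm z"
            using norm_cauchy_schwarz[of z w] w(2) by (simp add: mult.commute)
        qed
      qed (use F in auto)
    qed
    also have "\<dots> = sqrt 2 * (\<integral>z. norm z \<partial>?\<gamma>)" by simp
    also have "\<dots> \<le> sqrt 2 * sqrt (real CARD('n) + real CARD('m))"
      using std_gaussian_norm(2)[where 'a="(real^'n) \<times> (real^'m)"] by (intro mult_left_mono) auto
    finally show ?thesis .
  qed
  show "integrable std_gaussian (sup_bilinear :: real^'n^'m \<Rightarrow> real)"
    using integral_Sup_le(1)[OF ne cont meas B le mx] by (simp add: sup_bilinear_def[abs_def])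
  show "(\<integral>G. sup_bilinear G \<partial>(std_gaussian :: (real^'n^'m) measure)) \<le> sqrt 2 * sqrt (real CARD('n) + real CARD('m))"
    using integral_Sup_le(2)[OF ne cont meas B le mx] by (simp add: sup_bilinear_def[abs_def])
qed

section \<open>Symmetrization and contraction for Gaussian measurements\<close>

text \<open>Contraction for a single random sign, written as the sum over both signs. Let
  \<open>h\<close> and \<open>k\<close> be maximizers on the left. If \<open>l h \<ge> 0\<close>,
  then \<open>h\<close> competes in the first maximum on the right and \<open>k\<close> in the
  second, otherwise the other way round; \<open>- \<bar>l k\<bar>\<close> is at most both
  \<open>l k\<close> and \<open>- l k\<close>.\<close>

lemma Max_contraction_abs:
  fixes q l :: "'i \<Rightarrow> real"
  assumes I: "finite I" "I \<noteq> {}"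
  shows "Max ((\<lambda>h. q h + 2 * \<bar>l h\<bar>) ` I) + Max ((\<lambda>h. q h - 2 * \<bar>l h\<bar>) ` I) \<le>
    Max ((\<lambda>h. q h + 2 * l h) ` I) + Max ((\<lambda>h. q h - 2 * l h) ` I)"
proof -
  have att: "\<exists>h\<in>I. Max (f ` I) = f h" for f :: "'i \<Rightarrow> real"
  proof -
    have "Max (f ` I) \<in> f ` I" using I by (intro Max_in) auto
    then show ?thesis by blast
  qed
  obtain h where h: "h \<in> I" "Max ((\<lambda>h. q h + 2 * \<bar>l h\<bar>) ` I) = q h + 2 * \<bar>l h\<bar>" using att by blast
  obtain k where k: "k \<in> I" "Max ((\<lambda>h. q h - 2 * \<bar>l h\<bar>) ` I) = q k - 2 * \<bar>l k\<bar>" using att by blast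
  have up: "q i + 2 * l i \<le> Max ((\<lambda>h. q h + 2 * l h) ` I)" "q i - 2 * l i \<le> Max ((\<lambda>h. q h - 2 * l h) ` I)" if "i \<in> I" for i
    using that I(1) by (auto intro!: Max_ge)
  show ?thesis
    unfolding h(2) k(2) using up[OF h(1)] up[OF k(1)] by (cases "l h \<ge> 0") auto
qed

text \<open>Symmetrization needs no random signs here: for each \<open>h\<close> the left-hand side is the
  average of \<open>q h + 2 * E \<bar>x \<bullet> h\<bar>\<close> and \<open>q h - 2 * \<bar>a \<bullet> h\<bar>\<close>.\<close>

lemma gaussian_coordinate_step:
  fixes q :: "'a::euclidean_space \<Rightarrow> real"
  assumes F: "finite F" "F \<noteq> {}"
  shows "(\<integral>a. Max ((\<lambda>h. q h + (sqrt (2 / pi) * norm h - \<bar>a \<bullet> h\<bar>)) ` F) \<partial>std_gaussian) \<le>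
    (\<integral>a. Max ((\<lambda>h. q h + 2 * (a \<bullet> h)) ` F) \<partial>std_gaussian)"
proof -
  interpret A: prob_space "std_gaussian :: 'a measure" by (rule prob_space_std_gaussian)
  let ?\<gamma> = "std_gaussian :: 'a measure"
  have int: "integrable ?\<gamma> (\<lambda>a. Max ((\<lambda>h. q h + r h * \<bar>a \<bullet> h\<bar> + s * (a \<bullet> h)) ` F))" for q r :: "'a \<Rightarrow> real" and s
  proof (rule Bochner_Integration.integrable_bound)
    show "integrable ?\<gamma> (\<lambda>a. \<Sum>h\<in>F. \<bar>q h\<bar> + \<bar>r h\<bar> * \<bar>a \<bullet> h\<bar> + \<bar>s\<bar> * \<bar>a \<bullet> h\<bar>)"
      using integrable_std_gaussian_abs_moment[where k=1 and 'a='a]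
      by (intro Bochner_Integration.integrable_sum Bochner_Integration.integrable_add integrable_mult_right A.integrable_const) simp_all
    show "AE a in ?\<gamma>. norm (Max ((\<lambda>h. q h + r h * \<bar>a \<bullet> h\<bar> + s * (a \<bullet> h)) ` F)) \<le> norm (\<Sum>h\<in>F. \<bar>q h\<bar> + \<bar>r h\<bar> * \<bar>a \<bullet> h\<bar> + \<bar>s\<bar> * \<bar>a \<bullet> h\<bar>)"
    proof (intro always_eventually allI)
      fix a
      have "\<bar>Max ((\<lambda>h. q h + r h * \<bar>a \<bullet> h\<bar> + s * (a \<bullet> h)) ` F)\<bar> \<le> (\<Sum>h\<in>F. \<bar>q h + r h * \<bar>a \<bullet> h\<bar> + s * (a \<bullet> h)\<bar>)"
        by (rule abs_Max_le_sum_abs[OF F])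
      also have "\<dots> \<le> (\<Sum>h\<in>F. \<bar>q h\<bar> + \<bar>r h\<bar> * \<bar>a \<bullet> h\<bar> + \<bar>s\<bar> * \<bar>a \<bullet> h\<bar>)"
        by (intro sum_mono order_trans[OF abs_triangle_ineq] add_mono) (auto simp: abs_mult)
      finally show "norm (Max ((\<lambda>h. q h + r h * \<bar>a \<bullet> h\<bar> + s * (a \<bullet> h)) ` F)) \<le> norm (\<Sum>h\<in>F. \<bar>q h\<bar> + \<bar>r h\<bar> * \<bar>a \<bullet> h\<bar> + \<bar>s\<bar> * \<bar>a \<bullet> h\<bar>)"
        unfolding real_norm_def by (rule order_trans[OF _ abs_ge_self])
    qed
  qed (use F(1) in measurable)
  have plus: "integrable ?\<gamma> (\<lambda>a. Max ((\<lambda>h. q h + 2 * \<bar>a \<bullet> h\<bar>) ` F))"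
    using int[of q "\<lambda>_. 2" 0] by simp
  have minus: "integrable ?\<gamma> (\<lambda>a. Max ((\<lambda>h. q h - 2 * \<bar>a \<bullet> h\<bar>) ` F))"
    using int[of q "\<lambda>_. -2" 0] by simp
  have lplus: "integrable ?\<gamma> (\<lambda>a. Max ((\<lambda>h. q h + 2 * (a \<bullet> h)) ` F))"
    using int[of q "\<lambda>_. 0" 2] by simp
  have lminus: "integrable ?\<gamma> (\<lambda>a. Max ((\<lambda>h. q h - 2 * (a \<bullet> h)) ` F))"
    using int[of q "\<lambda>_. 0" "-2"] by simp
  \<comment> \<open>The mean of \<open>\<bar>x \<bullet> h\<bar>\<close> leaves the maximum because
    a maximum of means is at most the mean of the maximum.\<close>
  have le: "Max ((\<lambda>h. q h + (sqrt (2 / pi) * norm h - \<bar>a \<bullet> h\<bar>)) ` F) \<le>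
      ((\<integral>x. Max ((\<lambda>h. q h + 2 * \<bar>x \<bullet> h\<bar>) ` F) \<partial>?\<gamma>) + Max ((\<lambda>h. q h - 2 * \<bar>a \<bullet> h\<bar>) ` F)) / 2" for a
  proof (subst Max_le_iff, safe)
    fix h assume h: "h \<in> F"
    have "q h + 2 * (sqrt (2 / pi) * norm h) = (\<integral>x. q h + 2 * \<bar>x \<bullet> h\<bar> \<partial>?\<gamma>)"
      using std_gaussian_abs_moment_1[of h] A.prob_space by (simp add: has_bochner_integral_iff)
    also have "\<dots> \<le> (\<integral>x. Max ((\<lambda>h. q h + 2 * \<bar>x \<bullet> h\<bar>) ` F) \<partial>?\<gamma>)"
    proof (rule integral_mono[OF _ plus])
      show "integrable ?\<gamma> (\<lambda>x. q h + 2 * \<bar>x \<bullet> h\<bar>)"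
        using std_gaussian_abs_moment_1[of h] by (simp add: has_bochner_integral_iff)
      show "q h + 2 * \<bar>x \<bullet> h\<bar> \<le> Max ((\<lambda>h. q h + 2 * \<bar>x \<bullet> h\<bar>) ` F)" for x
        using h F(1) by (intro Max_ge) auto
    qed
    finally have plus_le: "q h + 2 * (sqrt (2 / pi) * norm h) \<le> (\<integral>x. Max ((\<lambda>h. q h + 2 * \<bar>x \<bullet> h\<bar>) ` F) \<partial>?\<gamma>)" .
    have minus_le: "q h - 2 * \<bar>a \<bullet> h\<bar> \<le> Max ((\<lambda>h. q h - 2 * \<bar>a \<bullet> h\<bar>) ` F)"
      using h F(1) by (intro Max_ge) auto
    have avg: "r + (s - t) \<le> (x + y) / 2" if "r + 2 * s \<le> x" "r - 2 * t \<le> y" for r s t x y :: real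
      using that by simp
    show "q h + (sqrt (2 / pi) * norm h - \<bar>a \<bullet> h\<bar>) \<le>
      ((\<integral>x. Max ((\<lambda>h. q h + 2 * \<bar>x \<bullet> h\<bar>) ` F) \<partial>?\<gamma>) + Max ((\<lambda>h. q h - 2 * \<bar>a \<bullet> h\<bar>) ` F)) / 2"
      by (rule avg[OF plus_le minus_le])
  qed (use F in auto)
  have "(\<integral>a. Max ((\<lambda>h. q h + (sqrt (2 / pi) * norm h - \<bar>a \<bullet> h\<bar>)) ` F) \<partial>?\<gamma>) \<le>
      (\<integral>a. ((\<integral>x. Max ((\<lambda>h. q h + 2 * \<bar>x \<bullet> h\<bar>) ` F) \<partial>?\<gamma>) + Max ((\<lambda>h. q h - 2 * \<bar>a \<bullet> h\<bar>) ` F)) / 2 \<partial>?\<gamma>)"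
  proof (rule integral_mono[OF _ _ le])
    show "integrable ?\<gamma> (\<lambda>a. Max ((\<lambda>h. q h + (sqrt (2 / pi) * norm h - \<bar>a \<bullet> h\<bar>)) ` F))"
      using int[of "\<lambda>h. q h + sqrt (2 / pi) * norm h" "\<lambda>_. -1" 0] by (simp add: algebra_simps)
  qed (use minus in auto)
  \<comment> \<open>The first term is constant under the outer integral and has the same law, so its
    variable can be identified with \<open>a\<close>. Both maxima then sit at the same point, as the
    pointwise contraction requires.\<close>
  also have "\<dots> = (\<integral>a. (Max ((\<lambda>h. q h + 2 * \<bar>a \<bullet> h\<bar>) ` F) + Max ((\<lambda>h. q h - 2 * \<bar>a \<bullet> h\<bar>) ` F)) / 2 \<partial>?\<gamma>)"
    using plus minus A.prob_space by simp
  also have "\<dots> \<le> (\<integral>a. (Max ((\<lambda>h. q h + 2 * (a \<bullet> h)) ` F) + Max ((\<lambda>h. q h - 2 * (a \<bullet> h)) ` F)) / 2 \<partial>?\<gamma>)"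
    using plus minus lplus lminus by (intro integral_mono divide_right_mono Max_contraction_abs[OF F]) auto
  also have "\<dots> = ((\<integral>a. Max ((\<lambda>h. q h + 2 * (a \<bullet> h)) ` F) \<partial>?\<gamma>) + (\<integral>a. Max ((\<lambda>h. q h - 2 * (a \<bullet> h)) ` F) \<partial>?\<gamma>)) / 2"
    using lplus lminus by simp
  \<comment> \<open>Symmetry of the Gaussian law under negation makes the two linear maxima equal in
    mean, which undoes the averaging over the sign.\<close>
  also have "(\<integral>a. Max ((\<lambda>h. q h - 2 * (a \<bullet> h)) ` F) \<partial>?\<gamma>) = (\<integral>a. Max ((\<lambda>h. q h + 2 * (a \<bullet> h)) ` F) \<partial>?\<gamma>)"
  proof -
    have "(\<integral>a. Max ((\<lambda>h. q h + 2 * (a \<bullet> h)) ` F) \<partial>?\<gamma>) = (\<integral>a. Max ((\<lambda>h. q h + 2 * (a \<bullet> h)) ` F) \<partial>distr ?\<gamma> borel uminus)"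
      by (simp add: distr_std_gaussian_uminus)
    also have "\<dots> = (\<integral>a. Max ((\<lambda>h. q h + 2 * (- a \<bullet> h)) ` F) \<partial>?\<gamma>)"
      using F(1) by (subst integral_distr) auto
    finally show ?thesis by simp
  qed
  finally show ?thesis by simp
qed

section \<open>All measurements together: replacing coordinates and adding them up\<close>

lemma product_prob_space_std_gaussian: "product_prob_space (\<lambda>_. std_gaussian)"
  by (simp add: prob_space_std_gaussian product_prob_space_def product_prob_space_axioms_def
      product_sigma_finite_def prob_space_imp_sigma_finite)

lemma integrable_PiM_std_gaussian_component:
  assumes "finite I" "i \<in> I"
  shows "integrable (\<Pi>\<^sub>M i\<in>I. std_gaussian) (\<lambda>a. norm (a i :: 'a::euclidean_space))"
proof -
  interpret product_prob_space "\<lambda>_. std_gaussian :: 'a measure" I by (rule product_prob_space_std_gaussian)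
  have "integrable (distr (\<Pi>\<^sub>M i\<in>I. std_gaussian) std_gaussian (\<lambda>a. a i)) (norm :: 'a \<Rightarrow> real)"
    using std_gaussian_norm(1) assms(2) by (simp add: PiM_component)
  then show ?thesis
    using assms(2) by (subst (asm) integrable_distr_eq) auto
qed

text \<open>Coordinates are replaced one at a time. In \<open>E K\<close> those in \<open>K\<close>
  already carry the linear term; when \<open>j\<close> is added, the contributions of all other
  coordinates are frozen and act as the arbitrary function \<open>q\<close> of
  \<open>gaussian_coordinate_step\<close>.\<close>

lemma gaussian_symmetrization_contraction:
  fixes F :: "'a::euclidean_space set"
  assumes F: "finite F" "F \<noteq> {}" and I: "finite I"
  shows "(\<integral>a. Max ((\<lambda>h. \<Sum>i\<in>I. sqrt (2 / pi) * norm h - \<bar>a i \<bullet> h\<bar>) ` F) \<partial>(\<Pi>\<^sub>M i\<in>I. std_gaussian)) \<le>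
    (\<integral>a. Max ((\<lambda>h. \<Sum>i\<in>I. 2 * (a i \<bullet> h)) ` F) \<partial>(\<Pi>\<^sub>M i\<in>I. std_gaussian))"
proof -
  interpret product_prob_space "\<lambda>_. std_gaussian :: 'a measure" I by (rule product_prob_space_std_gaussian)
  let ?P = "\<Pi>\<^sub>M i\<in>I. (std_gaussian :: 'a measure)"
  interpret P: prob_space ?P by (rule prob_space_PiM) (rule prob_space_std_gaussian)
  define \<phi> where "\<phi> b x h = (if b then 2 * (x \<bullet> h) else sqrt (2 / pi) * norm h - \<bar>x \<bullet> h\<bar>)" for b and x h :: 'a
  have \<phi>_component: "(\<lambda>a. \<phi> b (a i) h) \<in> borel_measurable ?P" if "i \<in> I" for b i h
  proof -
    have [measurable]: "(\<lambda>a. a i) \<in> ?P \<rightarrow>\<^sub>M borel"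
      using measurable_component_singleton[OF that, of "\<lambda>_. std_gaussian :: 'a measure"]
      by (simp cong: measurable_cong_sets)
    show ?thesis unfolding \<phi>_def by (cases b) simp_all
  qed
  have \<phi>_le: "\<bar>\<phi> b x h\<bar> \<le> 2 * norm h + 2 * norm h * norm x" for b x h
  proof -
    have abs_le: "\<bar>x \<bullet> h\<bar> \<le> norm h * norm x"
      using Cauchy_Schwarz_ineq2[of x h] by (simp add: mult.commute)
    show ?thesis
    proof (cases b)
      case True
      then have "\<bar>\<phi> b x h\<bar> = 2 * \<bar>x \<bullet> h\<bar>" by (simp add: \<phi>_def abs_mult)
      then show ?thesis using abs_le norm_ge_zero[of h] unfolding mult.assoc by linarith
    next
      case False
      have "sqrt (2 / pi) \<le> 1" using pi_ge_two by simp
      then have "sqrt (2 / pi) * norm h \<le> 1 * norm h" by (intro mult_right_mono) auto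
      moreover have "0 \<le> sqrt (2 / pi) * norm h" by simp
      moreover have "\<bar>s - t\<bar> \<le> 2 * n + 2 * m" if "s \<le> 1 * n" "0 \<le> s" "0 \<le> t" "t \<le> m" for s t n m :: real
        using that by linarith
      ultimately show ?thesis
        using False abs_le unfolding \<phi>_def mult.assoc by simp
    qed
  qed
  define E where "E K = (\<integral>a. Max ((\<lambda>h. \<Sum>i\<in>I. \<phi> (i \<in> K) (a i) h) ` F) \<partial>?P)" for K
  have meas: "(\<lambda>a. Max ((\<lambda>h. \<Sum>i\<in>I. \<phi> (i \<in> K) (a i) h) ` F)) \<in> borel_measurable ?P" for K
    by (intro borel_measurable_Max F(1) borel_measurable_sum \<phi>_component)
  have int: "integrable ?P (\<lambda>a. Max ((\<lambda>h. \<Sum>i\<in>I. \<phi> (i \<in> K) (a i) h) ` F))" for K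
  proof (rule Bochner_Integration.integrable_bound[OF _ meas])
    show "integrable ?P (\<lambda>a. \<Sum>h\<in>F. \<Sum>i\<in>I. 2 * norm h + 2 * norm h * norm (a i))"
      using integrable_PiM_std_gaussian_component[OF I]
      by (intro Bochner_Integration.integrable_sum Bochner_Integration.integrable_add integrable_mult_right P.integrable_const) auto
    show "AE a in ?P. norm (Max ((\<lambda>h. \<Sum>i\<in>I. \<phi> (i \<in> K) (a i) h) ` F)) \<le> norm (\<Sum>h\<in>F. \<Sum>i\<in>I. 2 * norm h + 2 * norm h * norm (a i))"
    proof (intro always_eventually allI)
      fix a
      have "\<bar>Max ((\<lambda>h. \<Sum>i\<in>I. \<phi> (i \<in> K) (a i) h) ` F)\<bar> \<le> (\<Sum>h\<in>F. \<bar>\<Sum>i\<in>I. \<phi> (i \<in> K) (a i) h\<bar>)"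
        by (rule abs_Max_le_sum_abs[OF F])
      also have "\<dots> \<le> (\<Sum>h\<in>F. \<Sum>i\<in>I. 2 * norm h + 2 * norm h * norm (a i))"
        by (intro sum_mono order_trans[OF sum_abs] \<phi>_le)
      finally show "norm (Max ((\<lambda>h. \<Sum>i\<in>I. \<phi> (i \<in> K) (a i) h) ` F)) \<le> norm (\<Sum>h\<in>F. \<Sum>i\<in>I. 2 * norm h + 2 * norm h * norm (a i))"
        unfolding real_norm_def by (rule order_trans[OF _ abs_ge_self])
    qed
  qed
  have step: "E K \<le> E (insert j K)" if j: "j \<in> I" "j \<notin> K" for K j
  proof -
    define J where "J = I - {j}"
    have J: "I = insert j J" "finite J" "j \<notin> J" using j I by (auto simp: J_def)
    let ?J = "\<Pi>\<^sub>M i\<in>J. (std_gaussian :: 'a measure)"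
    interpret A: prob_space "std_gaussian :: 'a measure" by (rule prob_space_std_gaussian)
    interpret J: prob_space ?J by (rule prob_space_PiM) (rule prob_space_std_gaussian)
    interpret AJ: pair_prob_space "std_gaussian :: 'a measure" ?J ..
    define f where "f L x y = Max ((\<lambda>h. (\<Sum>i\<in>J. \<phi> (i \<in> L) (x i) h) + \<phi> (j \<in> L) y h) ` F)" for L x y
    have f: "Max ((\<lambda>h. \<Sum>i\<in>I. \<phi> (i \<in> L) ((x(j := y)) i) h) ` F) = f L x y" for L x y
      unfolding f_def
    proof (intro arg_cong[where f=Max] image_cong refl)
      fix h
      have "(\<Sum>i\<in>J. \<phi> (i \<in> L) ((x(j := y)) i) h) = (\<Sum>i\<in>J. \<phi> (i \<in> L) (x i) h)"
        using J(3) by (intro sum.cong) auto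
      then show "(\<Sum>i\<in>I. \<phi> (i \<in> L) ((x(j := y)) i) h) = (\<Sum>i\<in>J. \<phi> (i \<in> L) (x i) h) + \<phi> (j \<in> L) y h"
        unfolding J(1) using J by simp
    qed
    \<comment> \<open>The product over \<open>I\<close> is rebuilt from coordinate \<open>j\<close>
      and the product over \<open>J\<close>, so that the coordinate to be replaced becomes the inner
      integral.\<close>
    have P: "?P = distr (std_gaussian \<Otimes>\<^sub>M ?J) ?P (\<lambda>(y, x). x(j := y))"
      unfolding J(1) by (rule distr_pair_PiM_eq_PiM[symmetric]) (rule prob_space_std_gaussian)+
    have upd: "(\<lambda>(y, x). x(j := y)) \<in> std_gaussian \<Otimes>\<^sub>M ?J \<rightarrow>\<^sub>M ?P"
      unfolding J(1) split_beta' by (rule measurable_fun_upd[where J=J]) auto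
    have pair: "integrable (std_gaussian \<Otimes>\<^sub>M ?J) (\<lambda>(y, x). f L x y)" for L
    proof -
      have "integrable (distr (std_gaussian \<Otimes>\<^sub>M ?J) ?P (\<lambda>(y, x). x(j := y))) (\<lambda>a. Max ((\<lambda>h. \<Sum>i\<in>I. \<phi> (i \<in> L) (a i) h) ` F))"
        using int[of L] P by simp
      from integrable_distr[OF upd this] show ?thesis by (simp add: split_beta' f del: fun_upd_apply)
    qed
    have E: "E L = (\<integral>x. \<integral>y. f L x y \<partial>std_gaussian \<partial>?J)" for L
    proof -
      have "E L = (\<integral>a. Max ((\<lambda>h. \<Sum>i\<in>I. \<phi> (i \<in> L) (a i) h) ` F) \<partial>distr (std_gaussian \<Otimes>\<^sub>M ?J) ?P (\<lambda>(y, x). x(j := y)))"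
        using P by (simp add: E_def)
      also have "\<dots> = (\<integral>z. f L (snd z) (fst z) \<partial>(std_gaussian \<Otimes>\<^sub>M ?J))"
        by (subst integral_distr[OF upd meas]) (simp add: split_beta' f del: fun_upd_apply)
      also have "\<dots> = (\<integral>x. \<integral>y. f L x y \<partial>std_gaussian \<partial>?J)"
        using AJ.integral_snd[OF pair] by (simp add: split_beta')
      finally show ?thesis .
    qed
    have "f K x = (\<lambda>y. Max ((\<lambda>h. (\<Sum>i\<in>J. \<phi> (i \<in> K) (x i) h) + (sqrt (2 / pi) * norm h - \<bar>y \<bullet> h\<bar>)) ` F))"
      "f (insert j K) x = (\<lambda>y. Max ((\<lambda>h. (\<Sum>i\<in>J. \<phi> (i \<in> K) (x i) h) + 2 * (y \<bullet> h)) ` F))" for x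
    proof -
      have "(i \<in> insert j K) = (i \<in> K)" if "i \<in> J" for i using that J(3) by auto
      then have rest: "(\<Sum>i\<in>J. \<phi> (i \<in> insert j K) (x i) h) = (\<Sum>i\<in>J. \<phi> (i \<in> K) (x i) h)" for h
        by (intro sum.cong refl) simp
      have new: "\<phi> (j \<in> insert j K) y h = 2 * (y \<bullet> h)" "\<phi> (j \<in> K) y h = sqrt (2 / pi) * norm h - \<bar>y \<bullet> h\<bar>" for y h
        using j by (simp_all add: \<phi>_def)
      show "f K x = (\<lambda>y. Max ((\<lambda>h. (\<Sum>i\<in>J. \<phi> (i \<in> K) (x i) h) + (sqrt (2 / pi) * norm h - \<bar>y \<bullet> h\<bar>)) ` F))"
        "f (insert j K) x = (\<lambda>y. Max ((\<lambda>h. (\<Sum>i\<in>J. \<phi> (i \<in> K) (x i) h) + 2 * (y \<bullet> h)) ` F))"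
        by (intro ext; simp only: f_def rest new)+
    qed
    then have "(\<integral>y. f K x y \<partial>std_gaussian) \<le> (\<integral>y. f (insert j K) x y \<partial>std_gaussian)" for x
      by (simp add: gaussian_coordinate_step[OF F])
    then show ?thesis
      unfolding E by (rule integral_mono[OF AJ.integrable_snd[OF pair] AJ.integrable_snd[OF pair]])
  qed
  have "E {} \<le> E K" if "K \<subseteq> I" "finite K" for K
    using that(2,1)
  proof (induction K rule: finite_induct)
    case (insert j K)
    then show ?case using step[of j K] by auto
  qed simp
  from this[of I] I have "E {} \<le> E I" by simp
  moreover have "E I = (\<integral>a. Max ((\<lambda>h. \<Sum>i\<in>I. 2 * (a i \<bullet> h)) ` F) \<partial>?P)"
    unfolding E_def by (intro Bochner_Integration.integral_cong refl arg_cong[where f=Max] image_cong sum.cong) (simp add: \<phi>_def)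
  ultimately show ?thesis by (simp add: E_def \<phi>_def)
qed

text \<open>Integrating out one coordinate turns \<open>f\<close> into \<open>g\<close>, again of
  linear growth but with a larger constant, so the induction runs over all \<open>f\<close> and
  \<open>K\<close>. The new coordinate raises the variance from \<open>card I\<close> to
  \<open>card I + 1\<close>, which is \<open>std_gaussian_integral_split\<close> with
  \<open>u = 1\<close>.\<close>

lemma integral_sum_std_gaussian:
  fixes f :: "'a::euclidean_space \<Rightarrow> real"
  assumes "finite I" "f \<in> borel_measurable borel" "\<And>x. \<bar>f x\<bar> \<le> K * (1 + norm x)"
  shows "(\<integral>a. f (\<Sum>i\<in>I. a i) \<partial>(\<Pi>\<^sub>M i\<in>I. std_gaussian)) = (\<integral>x. f (sqrt (card I) *\<^sub>R x) \<partial>std_gaussian)"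
  using assms
proof (induction I arbitrary: f K rule: finite_induct)
  case empty
  interpret A: prob_space "std_gaussian :: 'a measure" by (rule prob_space_std_gaussian)
  interpret P: prob_space "\<Pi>\<^sub>M i\<in>({} :: 'b set). (std_gaussian :: 'a measure)"
    by (rule prob_space_PiM) (rule prob_space_std_gaussian)
  show ?case using A.prob_space P.prob_space by simp
next
  case (insert j I)
  interpret A: prob_space "std_gaussian :: 'a measure" by (rule prob_space_std_gaussian)
  interpret product_prob_space "\<lambda>_. std_gaussian :: 'a measure" I by (rule product_prob_space_std_gaussian)
  interpret PI: prob_space "\<Pi>\<^sub>M i\<in>insert j I. (std_gaussian :: 'a measure)"
    by (rule prob_space_PiM) (rule prob_space_std_gaussian)
  note [measurable] = insert.prems(1)
  have K: "K \<ge> 0" using insert.prems(2)[of 0] by simp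
  define g where "g s = (\<integral>y. f (s + y) \<partial>std_gaussian)" for s
  have int: "integrable (\<Pi>\<^sub>M i\<in>insert j I. std_gaussian) (\<lambda>a. f (\<Sum>i\<in>insert j I. a i))"
  proof (rule Bochner_Integration.integrable_bound)
    show "integrable (\<Pi>\<^sub>M i\<in>insert j I. std_gaussian) (\<lambda>a :: 'b \<Rightarrow> 'a. K * (1 + (\<Sum>i\<in>insert j I. norm (a i))))"
      using insert.hyps(1)
      by (intro integrable_mult_right Bochner_Integration.integrable_add PI.integrable_const
          Bochner_Integration.integrable_sum integrable_PiM_std_gaussian_component) auto
    show "AE a in \<Pi>\<^sub>M i\<in>insert j I. std_gaussian. norm (f (\<Sum>i\<in>insert j I. a i)) \<le> norm (K * (1 + (\<Sum>i\<in>insert j I. norm (a i))))"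
    proof (intro always_eventually allI)
      fix a :: "'b \<Rightarrow> 'a"
      have "\<bar>f (\<Sum>i\<in>insert j I. a i)\<bar> \<le> K * (1 + (\<Sum>i\<in>insert j I. norm (a i)))"
        using insert.prems(2) by (rule order_trans) (intro mult_left_mono add_left_mono norm_sum K)
      then show "norm (f (\<Sum>i\<in>insert j I. a i)) \<le> norm (K * (1 + (\<Sum>i\<in>insert j I. norm (a i))))"
        unfolding real_norm_def by (rule order_trans[OF _ abs_ge_self])
    qed
    have "(\<lambda>a. \<Sum>i\<in>insert j I. a i) \<in> (\<Pi>\<^sub>M i\<in>insert j I. std_gaussian) \<rightarrow>\<^sub>M (borel :: 'a measure)"
    proof (rule borel_measurable_sum)
      fix i assume "i \<in> insert j I"
      then have "(\<lambda>a. a i) \<in> (\<Pi>\<^sub>M i\<in>insert j I. std_gaussian) \<rightarrow>\<^sub>M (std_gaussian :: 'a measure)"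
        by (rule measurable_component_singleton)
      then show "(\<lambda>a. a i) \<in> (\<Pi>\<^sub>M i\<in>insert j I. std_gaussian) \<rightarrow>\<^sub>M (borel :: 'a measure)"
        by (simp cong: measurable_cong_sets)
    qed
    then show "(\<lambda>a. f (\<Sum>i\<in>insert j I. a i)) \<in> borel_measurable (\<Pi>\<^sub>M i\<in>insert j I. std_gaussian)"
      by (rule measurable_compose) (rule insert.prems(1))
  qed
  have shift: "\<bar>f (s + y)\<bar> \<le> K * (1 + norm s) + K * norm y" for s y
  proof -
    have "\<bar>f (s + y)\<bar> \<le> K * (1 + norm (s + y))" by (rule insert.prems(2))
    also have "\<dots> \<le> K * (1 + (norm s + norm y))" by (intro mult_left_mono add_left_mono norm_triangle_ineq K)
    finally show ?thesis by (simp add: algebra_simps)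
  qed
  have g_meas: "g \<in> borel_measurable borel" unfolding g_def by measurable
  let ?N = "\<integral>y. norm y \<partial>(std_gaussian :: 'a measure)"
  have g_le: "\<bar>g s\<bar> \<le> (K * (1 + ?N)) * (1 + norm s)" for s
  proof -
    have N: "?N \<ge> 0" by simp
    have i: "integrable std_gaussian (\<lambda>y :: 'a. K * (1 + norm s) + K * norm y)"
      by (intro Bochner_Integration.integrable_add A.integrable_const integrable_mult_right std_gaussian_norm(1))
    have i2: "integrable std_gaussian (\<lambda>y. f (s + y))"
    proof (rule Bochner_Integration.integrable_bound[OF i])
      show "AE y in std_gaussian. norm (f (s + y)) \<le> norm (K * (1 + norm s) + K * norm y)"
        unfolding real_norm_def using order_trans[OF shift abs_ge_self] by (intro always_eventually allI)
    qed measurable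
    have "(\<integral>y. \<bar>f (s + y)\<bar> \<partial>std_gaussian) \<le> (\<integral>y. K * (1 + norm s) + K * norm y \<partial>(std_gaussian :: 'a measure))"
    proof (rule integral_mono)
      show "integrable std_gaussian (\<lambda>y. \<bar>f (s + y)\<bar>)" using i2 by simp
    qed (rule i, rule shift)
    also have "\<dots> = K * (1 + norm s) + K * ?N"
      using std_gaussian_norm(1)[where 'a='a] A.prob_space by (subst Bochner_Integration.integral_add) auto
    also have "\<dots> \<le> (K * (1 + ?N)) * (1 + norm s)"
      using K N by (simp add: algebra_simps)
    finally show ?thesis
      unfolding g_def by (rule order_trans[OF integral_abs_bound])
  qed
  have "(\<integral>a. f (\<Sum>i\<in>insert j I. a i) \<partial>(\<Pi>\<^sub>M i\<in>insert j I. std_gaussian)) =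
      (\<integral>x. \<integral>y. f (\<Sum>i\<in>insert j I. (x(j := y)) i) \<partial>std_gaussian \<partial>(\<Pi>\<^sub>M i\<in>I. std_gaussian))"
    using int by (rule product_integral_insert[OF insert.hyps])
  also have "\<dots> = (\<integral>x. g (\<Sum>i\<in>I. x i) \<partial>(\<Pi>\<^sub>M i\<in>I. std_gaussian))"
  proof -
    have "(\<Sum>i\<in>insert j I. (x(j := y)) i) = (\<Sum>i\<in>I. x i) + y" for x :: "'b \<Rightarrow> 'a" and y
    proof -
      have "(\<Sum>i\<in>I. (x(j := y)) i) = (\<Sum>i\<in>I. x i)"
        using insert.hyps(2) by (intro sum.cong) auto
      then show ?thesis using insert.hyps by (simp add: add.commute)
    qed
    then show ?thesis by (simp only: g_def)
  qed
  also have "\<dots> = (\<integral>x. g (sqrt (card I) *\<^sub>R x) \<partial>std_gaussian)"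
    by (rule insert.IH[OF g_meas g_le])
  also have "\<dots> = (\<integral>x. f (sqrt (card (insert j I)) *\<^sub>R x) \<partial>std_gaussian)"
    using std_gaussian_integral_split[OF insert.prems, of "sqrt (card (insert j I))" "sqrt (card I)" 1] insert.hyps
    by (simp add: g_def)
  finally show ?case .
qed

section \<open>Recovery of low-rank matrices\<close>

text \<open>Translates between matrix entries, indexed by pairs, and coordinates, indexed by basis
  matrices.\<close>

lemma (in prob_space) indep_vars_reindex_bij:
  assumes ind: "indep_vars (\<lambda>_. N) X (g ` I)" and inj: "inj_on g I"
  shows "indep_vars (\<lambda>_. N) (\<lambda>i. X (g i)) I"
  unfolding indep_vars_def2 indep_sets_def
proof (intro conjI ballI allI impI)
  have rv: "\<And>j. j \<in> g ` I \<Longrightarrow> random_variable N (X j)"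
    and sets: "\<And>j. j \<in> g ` I \<Longrightarrow> {X j -` A \<inter> space M |A. A \<in> sets N} \<subseteq> events"
    and prod: "\<And>J A. J \<subseteq> g ` I \<Longrightarrow> J \<noteq> {} \<Longrightarrow> finite J \<Longrightarrow>
      A \<in> (\<Pi> j\<in>J. {X j -` A \<inter> space M |A. A \<in> sets N}) \<Longrightarrow> prob (\<Inter>j\<in>J. A j) = (\<Prod>j\<in>J. prob (A j))"
    using ind unfolding indep_vars_def2 indep_sets_def by blast+
  show "random_variable N (X (g i))" if "i \<in> I" for i using rv that by blast
  show "{X (g i) -` A \<inter> space M |A. A \<in> sets N} \<subseteq> events" if "i \<in> I" for i
    using sets that by blast
  fix J A assume J: "J \<subseteq> I" "J \<noteq> {}" "finite J"
    and A: "A \<in> (\<Pi> j\<in>J. {X (g j) -` A \<inter> space M |A. A \<in> sets N})"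
  have inj': "inj_on g J" using inj J(1) by (rule inj_on_subset)
  let ?A = "\<lambda>j. A (the_inv_into J g j)"
  have inv: "the_inv_into J g (g j) = j" if "j \<in> J" for j
    using the_inv_into_f_f[OF inj' that] .
  have "prob (\<Inter>j\<in>g ` J. ?A j) = (\<Prod>j\<in>g ` J. prob (?A j))"
    using J A inv by (intro prod) (auto simp: Pi_iff)
  then show "prob (\<Inter>j\<in>J. A j) = (\<Prod>j\<in>J. prob (A j))"
    by (simp add: prod.reindex[OF inj'] inv cong: INF_cong)
qed

text \<open>The basis of the matrix space consists of the matrix units, and the inner products of
  \<open>G\<close> with them are its entries.\<close>

lemma (in prob_space) matrix_distr_std_gaussian:
  fixes G :: "'a \<Rightarrow> real^'n^'m"
  assumes ind: "indep_vars (\<lambda>_. borel) (\<lambda>(j, k) \<omega>. G \<omega> $ j $ k) UNIV"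
    and d: "\<And>j k. distributed M lborel (\<lambda>\<omega>. G \<omega> $ j $ k) std_normal_density"
  shows "distr M borel G = std_gaussian"
proof (rule distr_std_gaussianI)
  let ?e = "\<lambda>(j, k). axis j (axis k 1) :: real^'n^'m"
  have Basis: "(Basis :: (real^'n^'m) set) = range ?e"
    by (auto simp: Basis_vec_def)
  have inj: "inj ?e"
    by (auto simp: inj_def axis_eq_axis)
  have e: "G \<omega> \<bullet> ?e p = (case p of (j, k) \<Rightarrow> G \<omega> $ j $ k)" for \<omega> p
    by (cases p) (simp add: inner_axis)
  let ?g = "the_inv ?e"
  have g: "?g (?e p) = p" for p by (rule the_inv_f_f[OF inj])
  have gB: "?g ` Basis = UNIV"
    unfolding Basis image_image g by simp
  have injg: "inj_on ?g Basis"
    unfolding Basis by (rule inj_on_the_inv_into[OF inj])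
  have "indep_vars (\<lambda>_. borel) (\<lambda>b. (\<lambda>(j, k) \<omega>. G \<omega> $ j $ k) (?g b)) Basis"
    by (rule indep_vars_reindex_bij) (use ind gB injg in auto)
  moreover have "(\<lambda>(j, k) \<omega>. G \<omega> $ j $ k) (?g b) = (\<lambda>\<omega>. G \<omega> \<bullet> b)" if "b \<in> Basis" for b
  proof -
    obtain p where p: "b = ?e p" using \<open>b \<in> Basis\<close> unfolding Basis by blast
    show ?thesis unfolding p g e by (auto simp: split_beta')
  qed
  ultimately show "indep_vars (\<lambda>_. borel) (\<lambda>b \<omega>. G \<omega> \<bullet> b) Basis"
    by (subst (asm) indep_vars_cong[OF refl _ refl]) auto
  show "distributed M lborel (\<lambda>\<omega>. G \<omega> \<bullet> b) std_normal_density" if "b \<in> Basis" for b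
  proof -
    obtain p where p: "b = ?e p" using \<open>b \<in> Basis\<close> unfolding Basis by blast
    show ?thesis unfolding p e using d by (cases p) simp
  qed
qed

section \<open>A deterministic set for the rescaled errors\<close>

lemma onorm_matrix_le_norm: "onorm ((*v) G) \<le> norm G" for G :: "real^'n^'m"
proof -
  have "sup_bilinear G \<le> norm G"
    unfolding sup_bilinear_def
    by (rule cSUP_least) (use abs_le_D1[OF bilinear_le_norm[of _ _ G]] in auto)
  with onorm_le_sup_bilinear[of G] show ?thesis by linarith
qed

text \<open>By trace duality this set contains the nuclear-norm ball of radius \<open>R\<close>. Membership is additive in \<open>R\<close>
  by linearity, so the triangle inequality for the nuclear norm is not needed.\<close>

definition nuclear_polar :: "real \<Rightarrow> (real^'n^'m) set" where
  "nuclear_polar R = {h. \<forall>G. G \<bullet> h \<le> R * onorm ((*v) G)}"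

text \<open>Test against \<open>G = h\<close> and bound the operator norm by the Frobenius norm.
  Boundedness of the set later provides the integrable envelope of the supremum.\<close>

lemma norm_nuclear_polar:
  assumes "h \<in> nuclear_polar R" "R \<ge> 0"
  shows "norm h \<le> R"
proof (cases "h = 0")
  case False
  have "norm h * norm h \<le> R * onorm ((*v) h)"
    using assms(1) by (simp add: nuclear_polar_def norm_eq_sqrt_inner)
  also have "\<dots> \<le> R * norm h"
    using assms(2) onorm_matrix_le_norm by (intro mult_left_mono)
  finally show ?thesis using False by simp
qed (use assms in simp)

text \<open>\<open>X\<close> is feasible for its own measurements, so the minimizer has nuclear norm
  at most that of \<open>X\<close>. Trace duality is applied to \<open>Z\<close> with
  \<open>G\<close> and to \<open>X\<close> with \<open>- G\<close>, each at the cost of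
  \<open>sqrt r * norm X\<close>; dividing by \<open>norm X\<close> leaves a radius that depends on
  \<open>r\<close> alone.\<close>

lemma minimizer_error_in_nuclear_polar:
  fixes X Z :: "real^'n^'m"
  assumes min: "is_nuclear_minimizer a (\<lambda>i. mat_inner (a i) X) Z" and X: "X \<noteq> 0" "rank X \<le> r"
  shows "(1 / norm X) *\<^sub>R (Z - X) \<in> nuclear_polar (2 * sqrt r)" "a i \<bullet> ((1 / norm X) *\<^sub>R (Z - X)) = 0"
proof -
  have Z: "nuclear_norm Z \<le> nuclear_norm X" "a i \<bullet> Z = a i \<bullet> X"
    using min by (auto simp: is_nuclear_minimizer_def mat_inner_eq_inner)
  have "nuclear_norm X \<le> sqrt (rank X) * norm X" by (rule nuclear_norm_le_sqrt_rank)
  also have "\<dots> \<le> sqrt r * norm X" using X(2) by (intro mult_right_mono) auto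
  finally have X_le: "nuclear_norm X \<le> sqrt r * norm X" .
  show "a i \<bullet> ((1 / norm X) *\<^sub>R (Z - X)) = 0" using Z(2) by (simp add: inner_diff_right)
  show "(1 / norm X) *\<^sub>R (Z - X) \<in> nuclear_polar (2 * sqrt r)"
    unfolding nuclear_polar_def mem_Collect_eq
  proof
    fix G :: "real^'n^'m"
    have on: "onorm ((*v) G) \<ge> 0" by (rule onorm_pos_le[OF matrix_vector_mul_bounded_linear])
    have le: "H \<bullet> Y \<le> onorm ((*v) H) * (sqrt r * norm X)" if "nuclear_norm Y \<le> nuclear_norm X" for H Y :: "real^'n^'m"
      using inner_le_onorm_nuclear_norm[of H Y]
        mult_left_mono[of "nuclear_norm Y" "sqrt r * norm X" "onorm ((*v) H)"] that X_le
        onorm_pos_le[OF matrix_vector_mul_bounded_linear, of H] by linarith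
    have "(*v) (- G) = (\<lambda>x. - (G *v x))"
      by (simp add: fun_eq_iff vec_eq_iff matrix_vector_mult_def sum_negf)
    then have "onorm ((*v) (- G)) = onorm ((*v) G)"
      using onorm_neg[of "(*v) G"] by simp
    with le[of X "- G"] have "- (G \<bullet> X) \<le> onorm ((*v) G) * (sqrt r * norm X)" by simp
    with le[OF Z(1), of G] have "G \<bullet> (Z - X) \<le> 2 * (onorm ((*v) G) * (sqrt r * norm X))"
      by (simp add: inner_diff_right)
    then show "G \<bullet> ((1 / norm X) *\<^sub>R (Z - X)) \<le> 2 * sqrt r * onorm ((*v) G)"
      using X(1) by (simp only: inner_scaleR_right) (simp add: field_simps)
  qed
qed

theorem theorem10p1:
  fixes M :: "'w measure"
    and A :: "'m::finite \<Rightarrow> 'w \<Rightarrow> real^'d2^'d1"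
    and Xhat :: "('m \<Rightarrow> real^'d2^'d1) \<Rightarrow> ('m \<Rightarrow> real) \<Rightarrow> real^'d2^'d1"
    and r :: nat
  assumes "prob_space M"
    and "1 \<le> r" and "r \<le> min CARD('d1) CARD('d2)"
    and "prob_space.indep_vars M (\<lambda>_. borel) A UNIV"
    and "\<And>i. prob_space.indep_vars M (\<lambda>_. borel) (\<lambda>(j, k) \<omega>. A i \<omega> $ j $ k) UNIV"
    and "\<And>i j k. distributed M lborel (\<lambda>\<omega>. A i \<omega> $ j $ k) std_normal_density"
    and "\<And>\<omega> X y. \<omega> \<in> space M \<Longrightarrow> y = (\<lambda>i. mat_inner (A i \<omega>) X) \<Longrightarrow>
           is_nuclear_minimizer (\<lambda>i. A i \<omega>) y (Xhat (\<lambda>i. A i \<omega>) y)"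
  shows "outer_expectation M
           (\<lambda>\<omega>. SUP X \<in> {X. X \<noteq> 0 \<and> rank X \<le> r}.
              ennreal (norm (Xhat (\<lambda>i. A i \<omega>) (\<lambda>i. mat_inner (A i \<omega>) X) - X) / norm X))
         \<le> ennreal (4 * sqrt pi * sqrt (real r * (real CARD('d1) + real CARD('d2)) / real CARD('m)))"
proof -
  interpret prob_space M by fact
  let ?\<gamma> = "std_gaussian :: (real^'d2^'d1) measure"
  let ?P = "\<Pi>\<^sub>M i\<in>(UNIV :: 'm set). ?\<gamma>"
  define R where "R = 2 * sqrt r"
  define c where "c = sqrt (2 / pi)"
  define D where "D = real CARD('d1) + real CARD('d2)"
  let ?m = "real CARD('m)"
  have R: "R \<ge> 0" by (simp add: R_def)
  have c: "c > 0" by (simp add: c_def)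
  have Am [measurable]: "A i \<in> borel_measurable M" for i
    using assms(4) by (simp add: indep_vars_def)
  have A_distr: "distr M borel (A i) = ?\<gamma>" for i
    by (rule matrix_distr_std_gaussian[OF assms(5,6)])
  have "distr M (\<Pi>\<^sub>M i\<in>(UNIV :: 'm set). borel) (\<lambda>\<omega>. \<lambda>i\<in>UNIV. A i \<omega>) = (\<Pi>\<^sub>M i\<in>UNIV. distr M borel (A i))"
    using assms(4) by (subst (asm) indep_vars_iff_distr_eq_PiM) auto
  then have law: "distr M (\<Pi>\<^sub>M i\<in>(UNIV :: 'm set). borel) (\<lambda>\<omega> i. A i \<omega>) = ?P"
    by (simp add: A_distr restrict_def)
  define T where "T = (nuclear_polar R :: (real^'d2^'d1) set)"
  have T_norm: "norm h \<le> R" if "h \<in> T" for h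
    using norm_nuclear_polar[of h R] that R by (simp add: T_def)
  have T0: "0 \<in> T"
    using R onorm_pos_le[OF matrix_vector_mul_bounded_linear] by (auto simp: T_def nuclear_polar_def intro!: mult_nonneg_nonneg)
  define f where "f \<omega> h = (\<Sum>i\<in>UNIV. c * norm h - \<bar>A i \<omega> \<bullet> h\<bar>)" for \<omega> h
  \<comment> \<open>The factors are 2 from symmetrization, \<open>sqrt ?m\<close> from adding
    independent Gaussian matrices, \<open>R\<close> from the polar set, and last the bound on the
    expected operator norm.\<close>
  define c0 where "c0 = 2 * sqrt ?m * R * (sqrt 2 * sqrt D)"
  have finite_le: "(\<integral>\<omega>. Max (f \<omega> ` F) \<partial>M) \<le> c0" if F: "finite F" "F \<noteq> {}" "F \<subseteq> T" for F
  proof -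
    let ?l = "\<lambda>x. Max ((\<lambda>h. 2 * (x \<bullet> h)) ` F)"
    have l_le: "\<bar>?l x\<bar> \<le> (\<Sum>h\<in>F. 2 * norm h) * (1 + norm x)" for x
    proof -
      have "\<bar>?l x\<bar> \<le> (\<Sum>h\<in>F. \<bar>2 * (x \<bullet> h)\<bar>)" by (rule abs_Max_le_sum_abs[OF F(1,2)])
      also have "\<dots> \<le> (\<Sum>h\<in>F. 2 * norm h * norm x)"
      proof (rule sum_mono)
        fix h show "\<bar>2 * (x \<bullet> h)\<bar> \<le> 2 * norm h * norm x"
          using Cauchy_Schwarz_ineq2[of x h] by (simp add: abs_mult mult.commute)
      qed
      also have "\<dots> = (\<Sum>h\<in>F. 2 * norm h) * norm x" by (simp add: sum_distrib_right)
      also have "\<dots> \<le> (\<Sum>h\<in>F. 2 * norm h) * (1 + norm x)" by (intro mult_left_mono sum_nonneg) auto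
      finally show ?thesis .
    qed
    have "(\<integral>\<omega>. Max (f \<omega> ` F) \<partial>M) =
        (\<integral>a. Max ((\<lambda>h. \<Sum>i\<in>UNIV. c * norm h - \<bar>a i \<bullet> h\<bar>) ` F) \<partial>distr M (\<Pi>\<^sub>M i\<in>(UNIV :: 'm set). borel) (\<lambda>\<omega> i. A i \<omega>))"
      unfolding f_def using F(1) by (subst integral_distr) (auto intro!: measurable_PiM_single')
    also have "\<dots> \<le> (\<integral>a. Max ((\<lambda>h. \<Sum>i\<in>UNIV. 2 * (a i \<bullet> h)) ` F) \<partial>?P)"
      unfolding law c_def by (rule gaussian_symmetrization_contraction[OF F(1,2)]) simp
    \<comment> \<open>After contraction the process is linear, so it sees the measurements only
      through their sum, which is distributed as \<open>sqrt ?m\<close> times one Gaussian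
      matrix.\<close>
    also have "\<dots> = (\<integral>a. ?l (\<Sum>i\<in>UNIV. a i) \<partial>?P)"
      by (simp add: inner_sum_left sum_distrib_left)
    also have "\<dots> = (\<integral>x. ?l (sqrt ?m *\<^sub>R x) \<partial>?\<gamma>)"
      using F(1) by (intro integral_sum_std_gaussian[OF _ _ l_le]) auto
    also have "\<dots> \<le> (\<integral>x. 2 * sqrt ?m * R * sup_bilinear x \<partial>?\<gamma>)"
    proof (rule integral_mono)
      have "integrable ?\<gamma> (\<lambda>x. Max ((\<lambda>h. x \<bullet> ((2 * sqrt ?m) *\<^sub>R h)) ` F))"
        by (rule integrable_Max_std_gaussian[OF F(1,2)])
      then show "integrable ?\<gamma> (\<lambda>x. ?l (sqrt ?m *\<^sub>R x))" by (simp add: mult.assoc)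
      show "integrable ?\<gamma> (\<lambda>x. 2 * sqrt ?m * R * sup_bilinear x)"
        by (intro integrable_mult_right expectation_sup_bilinear(1))
      fix x :: "real^'d2^'d1"
      show "?l (sqrt ?m *\<^sub>R x) \<le> 2 * sqrt ?m * R * sup_bilinear x"
      proof (subst Max_le_iff, safe)
        fix h assume "h \<in> F"
        then have "x \<bullet> h \<le> R * onorm ((*v) x)" using F(3) by (auto simp: T_def nuclear_polar_def)
        also have "\<dots> \<le> R * sup_bilinear x" using R by (intro mult_left_mono onorm_le_sup_bilinear)
        finally have "2 * sqrt ?m * (x \<bullet> h) \<le> 2 * sqrt ?m * (R * sup_bilinear x)"
          by (rule mult_left_mono) simp
        then show "2 * (sqrt ?m *\<^sub>R x \<bullet> h) \<le> 2 * sqrt ?m * R * sup_bilinear x" by (simp add: mult.assoc)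
      qed (use F in auto)
    qed
    also have "\<dots> = 2 * sqrt ?m * R * (\<integral>x. sup_bilinear x \<partial>?\<gamma>)" by simp
    also have "\<dots> \<le> c0"
      unfolding c0_def D_def using R expectation_sup_bilinear(2)[where 'n='d2 and 'm='d1]
      by (intro mult_left_mono) (auto simp: add.commute)
    finally show ?thesis .
  qed
  \<comment> \<open>An envelope of \<open>f\<close> on \<open>T\<close>, obtained from
    \<open>norm h \<le> R\<close>; it is integrable because Gaussian norms are.\<close>
  define B where "B \<omega> = (\<Sum>i\<in>(UNIV :: 'm set). c * R + R * norm (A i \<omega>))" for \<omega>
  have B_int: "integrable M B"
  proof -
    have "integrable (distr M borel (A i)) norm" for i
      unfolding A_distr by (rule std_gaussian_norm(1))
    then have "integrable M (\<lambda>\<omega>. norm (A i \<omega>))" for i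
      by (subst (asm) integrable_distr_eq) auto
    then show ?thesis unfolding B_def by auto
  qed
  have f_le: "\<bar>f \<omega> h\<bar> \<le> B \<omega>" if "h \<in> T" for \<omega> h
  proof -
    have "\<bar>f \<omega> h\<bar> \<le> (\<Sum>i\<in>(UNIV :: 'm set). \<bar>c * norm h - \<bar>A i \<omega> \<bullet> h\<bar>\<bar>)" unfolding f_def by (rule sum_abs)
    also have "\<dots> \<le> B \<omega>"
      unfolding B_def
    proof (rule sum_mono)
      fix i
      have "\<bar>A i \<omega> \<bullet> h\<bar> \<le> norm (A i \<omega>) * norm h" by (rule Cauchy_Schwarz_ineq2)
      also have "\<dots> \<le> norm (A i \<omega>) * R" using T_norm[OF that] by (rule mult_left_mono) simp
      finally have "\<bar>A i \<omega> \<bullet> h\<bar> \<le> R * norm (A i \<omega>)" by (simp add: mult.commute)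
      moreover have "c * norm h \<le> c * R" "0 \<le> c * norm h" using T_norm[OF that] c by auto
      ultimately show "\<bar>c * norm h - \<bar>A i \<omega> \<bullet> h\<bar>\<bar> \<le> c * R + R * norm (A i \<omega>)" by linarith
    qed
    finally show ?thesis .
  qed
  have Tne: "T \<noteq> {}" using T0 by auto
  have cont: "continuous_on T (f \<omega>)" for \<omega>
    unfolding f_def by (intro continuous_intros)
  have f_meas: "(\<lambda>\<omega>. f \<omega> h) \<in> borel_measurable M" for h
    unfolding f_def by measurable
  define S where "S \<omega> = (SUP h\<in>T. f \<omega> h)" for \<omega>
  have S: "integrable M S" "(\<integral>\<omega>. S \<omega> \<partial>M) \<le> c0"
    unfolding S_def[abs_def] using integral_Sup_le[OF Tne cont f_meas B_int f_le finite_le] by auto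
  have bdd: "bdd_above (f \<omega> ` T)" for \<omega>
    by (intro bdd_aboveI2[where M="B \<omega>"]) (use abs_le_D1[OF f_le] in auto)
  have f_S: "f \<omega> h \<le> S \<omega>" if "h \<in> T" for \<omega> h
    unfolding S_def by (rule cSUP_upper[OF that bdd])
  \<comment> \<open>The process vanishes at \<open>h = 0\<close>. Nonnegativity lets the integral of
    \<open>S\<close> be computed in the extended nonnegative reals.\<close>
  have S_nonneg: "0 \<le> S \<omega>" for \<omega>
    using f_S[OF T0, of \<omega>] by (simp add: f_def)
  have cm: "c * ?m > 0" using c by simp
  \<comment> \<open>The right-hand side does not involve \<open>X\<close>, so for each outcome the
    bound survives the supremum over \<open>X\<close>, whichever minimizers \<open>Xhat\<close>
    selects.\<close>
  have error: "norm (Xhat (\<lambda>i. A i \<omega>) (\<lambda>i. mat_inner (A i \<omega>) X) - X) / norm X \<le> S \<omega> / (c * ?m)"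
    if \<omega>: "\<omega> \<in> space M" and X: "X \<noteq> 0" "rank X \<le> r" for \<omega> X
  proof -
    let ?h = "(1 / norm X) *\<^sub>R (Xhat (\<lambda>i. A i \<omega>) (\<lambda>i. mat_inner (A i \<omega>) X) - X)"
    note h = minimizer_error_in_nuclear_polar[OF assms(7)[OF \<omega> refl] X]
    have "c * ?m * norm ?h = f \<omega> ?h"
      unfolding f_def h(2) by simp
    also have "\<dots> \<le> S \<omega>"
      using h(1) by (intro f_S) (simp add: T_def R_def)
    finally show ?thesis using cm by (simp add: pos_le_divide_eq mult.commute)
  qed
  \<comment> \<open>The measurable competitor in the infimum that defines
    \<open>outer_expectation\<close>; the errors themselves enter only through the pointwise
    bound.\<close>
  let ?g = "\<lambda>\<omega>. ennreal (S \<omega> / (c * ?m))"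
  have g_meas: "?g \<in> borel_measurable M" using S(1) by measurable
  have "outer_expectation M
           (\<lambda>\<omega>. SUP X \<in> {X. X \<noteq> 0 \<and> rank X \<le> r}.
              ennreal (norm (Xhat (\<lambda>i. A i \<omega>) (\<lambda>i. mat_inner (A i \<omega>) X) - X) / norm X)) \<le> (\<integral>\<^sup>+\<omega>. ?g \<omega> \<partial>M)"
    unfolding outer_expectation_def
    by (rule INF_lower) (use g_meas error in \<open>auto intro!: SUP_least ennreal_leI\<close>)
  also have "\<dots> = ennreal ((\<integral>\<omega>. S \<omega> \<partial>M) / (c * ?m))"
    using S(1) S_nonneg cm by (subst nn_integral_eq_integral) auto
  also have "\<dots> \<le> ennreal (c0 / (c * ?m))"
    using S(2) cm by (intro ennreal_leI divide_right_mono) auto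
  also have "c0 / (c * ?m) = 4 * sqrt pi * sqrt (real r * D / ?m)"
  proof -
    have "c0 / (c * ?m) = 4 * (sqrt 2 / c) * (sqrt r * sqrt D) * (sqrt ?m / ?m)"
      using c by (simp add: c0_def R_def field_simps)
    also have "sqrt 2 / c = sqrt pi" by (simp add: c_def real_sqrt_divide)
    also have "sqrt ?m / ?m = 1 / sqrt ?m" by (simp add: real_div_sqrt field_simps)
    finally show ?thesis by (simp add: real_sqrt_mult real_sqrt_divide)
  qed
  finally show ?thesis unfolding D_def .
qed

end
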